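(* Let $\Omega \subset \mathbb{R}^n$ be a compact domain with smooth boundary. There exists a constant $c_{\Omega}$, depending only on $\Omega$, such that for all solutions $\phi_k$ of $-\Delta \phi_k = \lambda_k \phi_k$ in $\Omega$ that vanish on $\partial \Omega$, $$ \| D^2 \phi_k\|_{L^{\infty}(\Omega)} \leq c_{\Omega} \cdot \lambda_k^{1/2} \cdot \| \nabla \phi_k\|_{L^{\infty}(\Omega)}.$$
   Context: The functions $\phi_k$ are the Dirichlet eigenfunctions of the Laplacian on $\Omega$ with corresponding eigenvalues $\lambda_k > 0$ ($k$ indexes the eigenfunctions, and the constant $c_\Omega$ does not depend on $k$). $D^2\phi_k$ denotes the Hessian of $\phi_k$; its size at a point $x$ is measured by the largest absolute value of a second directional derivative, $\max_{\nu \in \mathbb{S}^{n-1}} |\frac{\partial^2 \phi_k}{\partial \nu^2}(x)|$ (any other matrix norm changes only the constant by a factor depending on $n$). *)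

theory Defs
  imports "HOL-Analysis.Analysis" "HOL-Probability.Essential_Supremum"
begin

definition dir_deriv :: "real ^ 'n \<Rightarrow> (real ^ 'n \<Rightarrow> real) \<Rightarrow> real ^ 'n \<Rightarrow> real"
  where "dir_deriv \<nu> f x = frechet_derivative f (at x) \<nu>"

abbreviation partial_deriv :: "'n \<Rightarrow> (real ^ 'n \<Rightarrow> real) \<Rightarrow> real ^ 'n \<Rightarrow> real"
  where "partial_deriv i \<equiv> dir_deriv (axis i 1)"

definition gradient :: "(real ^ 'n \<Rightarrow> real) \<Rightarrow> real ^ 'n \<Rightarrow> real ^ 'n"
  where "gradient f x = (\<chi> i. partial_deriv i f x)"

definition laplacian :: "(real ^ 'n \<Rightarrow> real) \<Rightarrow> real ^ 'n \<Rightarrow> real"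
  where "laplacian f x = (\<Sum>i\<in>UNIV. partial_deriv i (partial_deriv i f) x)"

definition hessian_size :: "(real ^ 'n \<Rightarrow> real) \<Rightarrow> real ^ 'n \<Rightarrow> ennreal"
  where "hessian_size f x = (SUP \<nu>\<in>sphere 0 1. ennreal \<bar>dir_deriv \<nu> (dir_deriv \<nu> f) x\<bar>)"

text \<open>The set argument is meant to be open; all derivatives are two-sided.\<close>

fun Ck_on :: "nat \<Rightarrow> (real ^ 'n) set \<Rightarrow> (real ^ 'n \<Rightarrow> real) \<Rightarrow> bool"
  where
    "Ck_on 0 S f \<longleftrightarrow> continuous_on S f"
  | "Ck_on (Suc k) S f \<longleftrightarrow> f differentiable_on S \<and> (\<forall>i. Ck_on k S (partial_deriv i f))"

definition smooth_on :: "(real ^ 'n) set \<Rightarrow> (real ^ 'n \<Rightarrow> real) \<Rightarrow> bool"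
  where "smooth_on S f \<longleftrightarrow> (\<forall>k. Ck_on k S f)"

text \<open>
  Near each of its boundary points the set is the sublevel set of a smooth function with
  nonvanishing gradient, so it lies locally on one side of a smooth hypersurface. The condition
  also forces a closed set satisfying it to be the closure of its interior.
\<close>

definition smooth_boundary :: "(real ^ 'n) set \<Rightarrow> bool"
  where "smooth_boundary \<Omega> \<longleftrightarrow>
    (\<forall>p\<in>frontier \<Omega>. \<exists>U \<rho>. open U \<and> p \<in> U \<and> smooth_on U \<rho> \<and>
       (\<forall>x\<in>U. gradient \<rho> x \<noteq> 0) \<and> \<Omega> \<inter> U = {x \<in> U. \<rho> x \<le> 0})"

definition smooth_compact_domain :: "(real ^ 'n) set \<Rightarrow> bool"
  where "smooth_compact_domain \<Omega> \<longleftrightarrow>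
    compact \<Omega> \<and> \<Omega> \<noteq> {} \<and> connected (interior \<Omega>) \<and> smooth_boundary \<Omega>"

text \<open>
  Classical Dirichlet eigenfunctions on a compact \<open>\<Omega>\<close>: twice continuously differentiable in the
  interior and continuous up to the boundary. Only the values on \<open>\<Omega>\<close> matter.
\<close>

definition dirichlet_eigenfunction :: "(real ^ 'n) set \<Rightarrow> real \<Rightarrow> (real ^ 'n \<Rightarrow> real) \<Rightarrow> bool"
  where "dirichlet_eigenfunction \<Omega> lam \<phi> \<longleftrightarrow>
    continuous_on \<Omega> \<phi> \<and> Ck_on 2 (interior \<Omega>) \<phi> \<and>
    (\<forall>x\<in>interior \<Omega>. - laplacian \<phi> x = lam * \<phi> x) \<and>
    (\<forall>x\<in>frontier \<Omega>. \<phi> x = 0) \<and>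
    (\<exists>x\<in>\<Omega>. \<phi> x \<noteq> 0)"

text \<open>
  The essential supremum is taken over the interior because derivatives are only controlled
  there; a smooth boundary is a null set. \<^const>\<open>esssup\<close> is \<open>top\<close> on non-measurable functions,
  but the gradient norm and Hessian size of a C2 function are measurable on the interior.
\<close>

definition Linf_norm :: "(real ^ 'n) set \<Rightarrow> (real ^ 'n \<Rightarrow> ennreal) \<Rightarrow> ennreal"
  where "Linf_norm \<Omega> g = esssup (lebesgue_on (interior \<Omega>)) g"

end

theory Submission
  imports Defs
begin

text \<open>
  Let \<open>M\<close> bound the gradient of \<open>\<phi>\<close>, so that the extension \<open>u\<close> of \<open>\<phi>\<close> by zero is \<open>M\<close>-Lipschitz, and put
  \<open>r = const / sqrt lam\<close>; such an \<open>r\<close> is small compared with \<open>\<Omega>\<close> because \<open>lam\<close> is bounded below. It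
  suffices to bound second derivatives by a multiple of \<open>M / r\<close>. No regularity of \<open>\<phi>\<close> up to the
  boundary, and no third derivative, is used: everything is done with difference quotients
  \<open>u \<circ> F - u\<close> for isometries \<open>F\<close> near the identity, which solve the same equation, and with
  quadratic barriers in the maximum principle.

  At distance at least \<open>r / 2\<close> from the boundary, apply an interior gradient estimate to translates.
  At distance \<open>d\<close> from a nearest boundary point \<open>p\<close> that is smaller, let \<open>e\<close> be tangent at \<open>p\<close> and choose
  rigid motions \<open>F\<^sub>t\<close> with velocity \<open>e\<close> at \<open>p\<close> whose velocity field is tangent to the boundary up
  to second order at \<open>p\<close>. Then \<open>u \<circ> F\<^sub>t - u\<close> is \<open>O(t |x - p|\<^sup>2)\<close> on the boundary, a barrier makes it
  \<open>O(t |x - p| / r)\<close> inside, and the interior gradient estimate on a ball of radius \<open>d / 2\<close> bounds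
  all second derivatives having one tangential direction. The remaining purely normal one is given
  by the equation.
\<close>

subsection \<open>Gradients, Hessians and the minimum principle\<close>

text \<open>Why rigid motions and not translations: the interior estimate divides by
  \<open>d\<close>, so the difference of \<open>u \<circ> F\<close> and \<open>u\<close> must be O(t
  d / r) at distance \<open>d\<close> from \<open>p\<close>. A translation along \<open>e\<close> is
  tangent to a curved boundary only to first order. Its boundary differences are merely O(t |x -
  p|), and a harmonic function with data of that size can reach the order d log (1 / d), so a
  logarithm would be lost; data of order t |x - p|^2 are dominated by a quadratic barrier. The
  correction has to preserve the Laplacian, and a rotation about \<open>p\<close> supplies exactly
  the missing freedom: an antisymmetric matrix can turn the normal at any prescribed rate.

  The two constraints on \<open>r\<close> have different origins. The zeroth-order term is harmless
  when \<open>lam * r^2 \<le> 1\<close>, while the boundary charts demand an upper bound on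
  \<open>r\<close> that ignores \<open>lam\<close>. A lower bound for the eigenvalue reconciles
  them, and M / r then produces the factor \<open>sqrt lam\<close>.

  Gradient and Hessian are carried as explicit functions, so that sums, multiples and compositions
  with isometries reduce to matrix algebra.\<close>

definition grad_hess_on ::
  "(real^'n) set \<Rightarrow> (real^'n \<Rightarrow> real) \<Rightarrow> (real^'n \<Rightarrow> real^'n) \<Rightarrow> (real^'n \<Rightarrow> real^'n^'n) \<Rightarrow> bool"
  where "grad_hess_on S f G H \<longleftrightarrow> open S \<and>
    (\<forall>x\<in>S. (f has_derivative (\<lambda>h. G x \<bullet> h)) (at x) \<and> (G has_derivative (\<lambda>h. H x *v h)) (at x))"

lemma grad_hess_on_subset:
  "grad_hess_on S f G H \<Longrightarrow> open T \<Longrightarrow> T \<subseteq> S \<Longrightarrow> grad_hess_on T f G H"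
  by (auto simp: grad_hess_on_def)

lemma grad_hess_on_add:
  assumes "grad_hess_on S f G H" "grad_hess_on S f' G' H'"
  shows "grad_hess_on S (\<lambda>x. f x + f' x) (\<lambda>x. G x + G' x) (\<lambda>x. H x + H' x)"
  using assms unfolding grad_hess_on_def
  by (auto intro!: derivative_eq_intros simp: inner_add_left matrix_vector_mult_add_rdistrib)

lemma grad_hess_on_diff:
  assumes "grad_hess_on S f G H" "grad_hess_on S f' G' H'"
  shows "grad_hess_on S (\<lambda>x. f x - f' x) (\<lambda>x. G x - G' x) (\<lambda>x. H x - H' x)"
  using assms unfolding grad_hess_on_def
  by (auto intro!: derivative_eq_intros simp: inner_diff_left matrix_vector_mult_diff_rdistrib)

lemma scaleR_matrix_vector_mult: "(c *\<^sub>R A) *v x = c *\<^sub>R (A *v x)" for A :: "real^'n^'m"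
  by (simp add: matrix_vector_mult_def vec_eq_iff sum_distrib_left mult.assoc)

lemma trace_scaleR: "trace (c *\<^sub>R A) = c * trace A" for A :: "real^'n^'n"
  by (simp add: trace_def sum_distrib_left)

lemma grad_hess_on_cmult:
  assumes "grad_hess_on S f G H"
  shows "grad_hess_on S (\<lambda>x. c * f x) (\<lambda>x. c *\<^sub>R G x) (\<lambda>x. c *\<^sub>R H x)"
  unfolding grad_hess_on_def
proof (intro conjI ballI)
  show "open S" using assms by (simp add: grad_hess_on_def)
  fix x assume x: "x \<in> S"
  show "((\<lambda>x. c * f x) has_derivative (\<lambda>h. (c *\<^sub>R G x) \<bullet> h)) (at x)"
    using has_derivative_mult_right[of f "\<lambda>h. G x \<bullet> h" "at x" c] assms x
    by (simp add: grad_hess_on_def)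
  show "((\<lambda>x. c *\<^sub>R G x) has_derivative (\<lambda>h. (c *\<^sub>R H x) *v h)) (at x)"
    using has_derivative_scaleR_right[of G "\<lambda>h. H x *v h" "at x" c] assms x
    by (simp add: grad_hess_on_def scaleR_matrix_vector_mult)
qed

section \<open>Composition with isometries\<close>

lemma orthogonal_transformation_adjoint:
  fixes q :: "real^'n \<Rightarrow> real^'n"
  assumes "orthogonal_transformation q"
  shows "v \<bullet> q w = (transpose (matrix q) *v v) \<bullet> w"
    and "q (transpose (matrix q) *v v) = v"
proof -
  have lin: "linear q" and om: "orthogonal_matrix (matrix q)"
    using assms orthogonal_transformation_matrix by auto
  have q: "matrix q *v x = q x" for x
    using lin by (simp add: matrix_works scalar_mult_eq_scaleR linear_def)
  show "v \<bullet> q w = (transpose (matrix q) *v v) \<bullet> w"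
    by (simp add: dot_lmul_matrix q)
  have "matrix q *v (transpose (matrix q) *v v) = v"
    using om unfolding orthogonal_matrix_def by (simp add: matrix_vector_mul_assoc del: transpose_matrix_vector)
  then show "q (transpose (matrix q) *v v) = v" by (simp only: q)
qed

lemma grad_hess_on_isometry:
  fixes f :: "real^'n \<Rightarrow> real" and q :: "real^'n \<Rightarrow> real^'n"
  assumes gh: "grad_hess_on S f G H" and q: "orthogonal_transformation q"
  shows "grad_hess_on {x. q x + b \<in> S} (\<lambda>x. f (q x + b))
     (\<lambda>x. transpose (matrix q) *v G (q x + b))
     (\<lambda>x. transpose (matrix q) ** H (q x + b) ** matrix q)"
  unfolding grad_hess_on_def
proof (intro conjI ballI)
  have lin: "linear q" using q by (simp add: orthogonal_transformation)
  then have bl: "bounded_linear q" by (simp add: linear_conv_bounded_linear)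
  have qm: "matrix q *v x = q x" for x
    using lin by (simp add: matrix_works scalar_mult_eq_scaleR linear_def)
  have S: "open S" using gh by (simp add: grad_hess_on_def)
  have cont: "continuous_on UNIV (\<lambda>x. q x + b)"
    using bl by (intro continuous_intros linear_continuous_on)
  show "open {x. q x + b \<in> S}"
    using open_vimage[OF S cont] by (simp add: vimage_def)
  fix x assume "x \<in> {x. q x + b \<in> S}"
  then have fd: "(f has_derivative (\<lambda>h. G (q x + b) \<bullet> h)) (at (q x + b))"
    and gd: "(G has_derivative (\<lambda>h. H (q x + b) *v h)) (at (q x + b))"
    using gh by (auto simp: grad_hess_on_def)
  have qd: "((\<lambda>x. q x + b) has_derivative q) (at x)"
    by (auto intro!: derivative_eq_intros bounded_linear_imp_has_derivative bl)
  show "((\<lambda>x. f (q x + b)) has_derivative (\<lambda>h. (transpose (matrix q) *v G (q x + b)) \<bullet> h)) (at x)"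
    using has_derivative_compose[OF qd fd] by (simp add: orthogonal_transformation_adjoint(1)[OF q])
  have "((\<lambda>x. G (q x + b)) has_derivative (\<lambda>h. H (q x + b) *v q h)) (at x)"
    using has_derivative_compose[OF qd gd] by simp
  from bounded_linear.has_derivative[OF matrix_vector_mul_bounded_linear[of "transpose (matrix q)"] this]
  show "((\<lambda>x. transpose (matrix q) *v G (q x + b)) has_derivative
      (\<lambda>h. (transpose (matrix q) ** H (q x + b) ** matrix q) *v h)) (at x)"
    by (simp add: qm matrix_vector_mul_assoc[symmetric] del: transpose_matrix_vector)
qed

text \<open>Invariance of the Laplacian under isometries, in matrix form: the reason why moved
  copies of a solution solve the same equation.\<close>

lemma trace_orthogonal_conjugate:
  fixes q :: "real^'n \<Rightarrow> real^'n"
  assumes "orthogonal_transformation q"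
  shows "trace (transpose (matrix q) ** A ** matrix q) = trace A"
proof -
  have "matrix q ** transpose (matrix q) = mat 1"
    using assms orthogonal_transformation_matrix by (auto simp: orthogonal_matrix_def)
  then show ?thesis
    by (metis trace_mul_sym matrix_mul_assoc matrix_mul_lid)
qed

section \<open>Minimum principle\<close>

lemma interior_min_trace_nonneg:
  assumes gh: "grad_hess_on S f G H" and x: "x \<in> S" and min: "\<And>y. y \<in> S \<Longrightarrow> f x \<le> f y"
  shows "trace (H x) \<ge> 0"
proof -
  have S: "open S" using gh by (simp add: grad_hess_on_def)
  have "H x $ i $ i \<ge> 0" for i
  proof (rule ccontr)
    let ?e = "axis i (1::real)"
    assume "\<not> H x $ i $ i \<ge> 0"
    then have neg: "H x $ i $ i < 0" by simp
    obtain e where e: "e > 0" "ball x e \<subseteq> S" using S x openE by blast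
    have in_S: "x + t *\<^sub>R ?e \<in> S" if "\<bar>t\<bar> < e" for t
      using that e by (intro subsetD[OF e(2)]) (simp add: dist_norm)
    have d1: "((\<lambda>t. f (x + t *\<^sub>R ?e)) has_real_derivative G (x + t *\<^sub>R ?e) $ i) (at t)"
      if "\<bar>t\<bar> < e" for t
    proof -
      have "(f has_derivative (\<lambda>h. G (x + t *\<^sub>R ?e) \<bullet> h)) (at (x + t *\<^sub>R ?e))"
        using gh in_S[OF that] by (auto simp: grad_hess_on_def)
      moreover have "((\<lambda>t. x + t *\<^sub>R ?e) has_derivative (\<lambda>h. h *\<^sub>R ?e)) (at t)"
        by (auto intro!: derivative_eq_intros)
      ultimately have "((\<lambda>t. f (x + t *\<^sub>R ?e)) has_derivative (\<lambda>h. G (x + t *\<^sub>R ?e) \<bullet> (h *\<^sub>R ?e))) (at t)"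
        using has_derivative_compose by blast
      then show ?thesis
        by (simp add: has_field_derivative_def inner_axis mult.commute[of _ "G (x + t *\<^sub>R ?e) $ i"])
    qed
    have d2: "((\<lambda>t. G (x + t *\<^sub>R ?e) $ i) has_real_derivative H x $ i $ i) (at 0)"
    proof -
      have "(G has_derivative (\<lambda>h. H x *v h)) (at (x + 0 *\<^sub>R ?e))"
        using gh x by (auto simp: grad_hess_on_def)
      moreover have "((\<lambda>t. x + t *\<^sub>R ?e) has_derivative (\<lambda>h. h *\<^sub>R ?e)) (at 0)"
        by (auto intro!: derivative_eq_intros)
      ultimately have "((\<lambda>t. G (x + t *\<^sub>R ?e)) has_derivative (\<lambda>h. H x *v (h *\<^sub>R ?e))) (at 0)"
        using has_derivative_compose by blast
      from bounded_linear.has_derivative[OF bounded_linear_vec_nth[of i] this]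
      show ?thesis
        by (simp add: has_field_derivative_def matrix_vector_mult_scaleR matrix_vector_mult_basis column_def
            mult.commute[of _ "H x $ i $ i"])
    qed
    have G0: "G x $ i = 0"
    proof -
      have "((\<lambda>t. f (x + t *\<^sub>R ?e)) has_real_derivative G x $ i) (at 0)" using d1[of 0] e by simp
      then show ?thesis
        by (rule DERIV_local_min[OF _ e(1)]) (use min in_S in auto)
    qed
    \<comment> \<open>The first derivative along the axis vanishes at the minimum. With a negative
      second derivative at this one point it is negative just to the right, so the mean value
      theorem makes \<open>f\<close> drop below its minimum.\<close>
    from DERIV_neg_dec_right[OF d2 neg] obtain d where d: "d > 0"
      and dd: "\<And>h. 0 < h \<Longrightarrow> h < d \<Longrightarrow> G (x + h *\<^sub>R ?e) $ i < 0" using G0 by auto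
    define t where "t = min d e / 2"
    have t: "0 < t" "t < d" "t < e" using d e by (auto simp: t_def)
    have "\<exists>z>0. z < t \<and> f (x + t *\<^sub>R ?e) - f (x + 0 *\<^sub>R ?e) = (t - 0) * G (x + z *\<^sub>R ?e) $ i"
      by (rule MVT2[OF t(1)]) (use t in \<open>auto intro!: d1\<close>)
    then obtain z where z: "0 < z" "z < t" "f (x + t *\<^sub>R ?e) - f x = t * G (x + z *\<^sub>R ?e) $ i"
      by auto
    have "t * G (x + z *\<^sub>R ?e) $ i < 0"
      using z t dd[of z] by (simp add: mult_pos_neg)
    moreover have "f x \<le> f (x + t *\<^sub>R ?e)" using t in_S[of t] min by simp
    ultimately show False using z by simp
  qed
  then show ?thesis by (auto simp: trace_def intro: sum_nonneg)
qed

text \<open>A minimum point over \<open>K\<close> cannot satisfy the second alternative, by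
  \<open>interior_min_trace_nonneg\<close>. Since the alternative is stated point by point, no
  description of the frontier of \<open>K\<close> is required: each application sorts the points of
  its own region.\<close>

lemma weak_minimum_principle:
  assumes K: "compact K" "continuous_on K v"
    and loc: "\<And>x. x \<in> K \<Longrightarrow> v x \<ge> 0 \<or>
      (\<exists>S G H. grad_hess_on S v G H \<and> x \<in> S \<and> S \<subseteq> K \<and> trace (H x) < 0)"
    and x: "x \<in> K"
  shows "v x \<ge> 0"
proof -
  obtain y where y: "y \<in> K" "\<And>z. z \<in> K \<Longrightarrow> v y \<le> v z"
    using continuous_attains_inf[OF K(1) _ K(2)] x by blast
  have "v y \<ge> 0"
    using loc[OF y(1)] y(2) interior_min_trace_nonneg by (metis linorder_not_le subsetD)
  then show ?thesis using y(2)[OF x] by simp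
qed

section \<open>Quadratic barriers\<close>

definition outer_square :: "real^'n \<Rightarrow> real^'n^'n"
  where "outer_square e = (\<chi> i j. e $ i * e $ j)"

lemma outer_square_mult: "outer_square e *v h = (e \<bullet> h) *\<^sub>R e"
  by (simp add: outer_square_def matrix_vector_mult_def vec_eq_iff inner_vec_def sum_distrib_left mult_ac)

lemma trace_outer_square: "trace (outer_square e) = (norm e)\<^sup>2"
  by (simp add: outer_square_def trace_def power2_norm_eq_inner inner_vec_def)

text \<open>All barriers have this shape: an isotropic quadratic that controls the far part of the
  boundary, a quadratic polynomial in one coordinate, whose coefficient \<open>c\<close> makes the
  Laplacian negative when \<open>a\<close> is positive, and a constant.\<close>

lemma grad_hess_on_quadratic:
  fixes p e :: "real^'n"
  shows "grad_hess_on UNIV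
    (\<lambda>x. a * ((x - p) \<bullet> (x - p)) + b * (e \<bullet> (x - p)) + c * (e \<bullet> (x - p))\<^sup>2 + d)
    (\<lambda>x. (2 * a) *\<^sub>R (x - p) + (b + 2 * c * (e \<bullet> (x - p))) *\<^sub>R e)
    (\<lambda>x. (2 * a) *\<^sub>R mat 1 + (2 * c) *\<^sub>R outer_square e)"
  unfolding grad_hess_on_def
proof (intro conjI ballI open_UNIV)
  fix x :: "real^'n"
  have "((\<lambda>x. a * ((x - p) \<bullet> (x - p)) + b * (e \<bullet> (x - p)) + c * (e \<bullet> (x - p))\<^sup>2 + d) has_derivative
    (\<lambda>h. a * ((x - p) \<bullet> h + h \<bullet> (x - p)) + b * (e \<bullet> h) + c * (2 * (e \<bullet> (x - p)) * (e \<bullet> h)))) (at x)"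
    by (auto intro!: derivative_eq_intros)
  then show "((\<lambda>x. a * ((x - p) \<bullet> (x - p)) + b * (e \<bullet> (x - p)) + c * (e \<bullet> (x - p))\<^sup>2 + d) has_derivative
    (\<lambda>h. ((2 * a) *\<^sub>R (x - p) + (b + 2 * c * (e \<bullet> (x - p))) *\<^sub>R e) \<bullet> h)) (at x)"
    by (rule has_derivative_eq_rhs) (simp add: fun_eq_iff inner_add_left inner_commute[of _ "x - p"] distrib_right distrib_left)
  have "((\<lambda>x. (2 * a) *\<^sub>R (x - p) + (b + 2 * c * (e \<bullet> (x - p))) *\<^sub>R e) has_derivative
     (\<lambda>h. (2 * a) *\<^sub>R h + (2 * c * (e \<bullet> h)) *\<^sub>R e)) (at x)"
    by (auto intro!: derivative_eq_intros)
  then show "((\<lambda>x. (2 * a) *\<^sub>R (x - p) + (b + 2 * c * (e \<bullet> (x - p))) *\<^sub>R e) has_derivative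
     (\<lambda>h. ((2 * a) *\<^sub>R mat 1 + (2 * c) *\<^sub>R outer_square e) *v h)) (at x)"
    by (simp add: matrix_vector_mult_add_rdistrib scaleR_matrix_vector_mult outer_square_mult)
qed

lemma trace_quadratic:
  "trace ((2 * a) *\<^sub>R mat 1 + (2 * c) *\<^sub>R outer_square e :: real^'n^'n)
    = 2 * a * CARD('n) + 2 * c * (norm e)\<^sup>2"
  by (simp add: trace_add trace_scaleR trace_outer_square trace_I)

subsection \<open>Interior gradient estimate\<close>

text \<open>Increments are bounded on the right only, and \<open>c\<close> may vary with
  \<open>t\<close>: error terms of higher order in \<open>t\<close> then disappear in the limit,
  however large their coefficients.\<close>

lemma norm_vector_derivative_le:
  fixes k :: "real \<Rightarrow> 'a::real_normed_vector"
  assumes k: "(k has_vector_derivative k') (at 0)"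
    and le: "\<forall>\<^sub>F t in at_right 0. norm (k t - k 0) \<le> t * c t"
    and c: "(c \<longlongrightarrow> l) (at_right 0)"
  shows "norm k' \<le> l"
proof -
  have "((\<lambda>y. ((k y - k 0) - (y - 0) *\<^sub>R k') /\<^sub>R norm (y - 0)) \<longlongrightarrow> 0) (at 0)"
    using k by (simp add: has_vector_derivative_def has_derivative_def)
  then have "((\<lambda>y. ((k y - k 0) - (y - 0) *\<^sub>R k') /\<^sub>R norm (y - 0)) \<longlongrightarrow> 0) (at_right 0)"
    by (rule tendsto_mono[rotated]) (simp add: at_le)
  then have "((\<lambda>y. c y + norm (((k y - k 0) - (y - 0) *\<^sub>R k') /\<^sub>R norm (y - 0))) \<longlongrightarrow> l + norm (0::'a)) (at_right 0)"
    by (intro tendsto_intros c)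
  then have lim: "((\<lambda>y. c y + norm (((k y - k 0) - (y - 0) *\<^sub>R k') /\<^sub>R norm (y - 0))) \<longlongrightarrow> l) (at_right 0)"
    by simp
  have "\<forall>\<^sub>F t in at_right 0. norm k' \<le> c t + norm (((k t - k 0) - (t - 0) *\<^sub>R k') /\<^sub>R norm (t - 0))"
    using le eventually_at_right_less[of 0]
  proof eventually_elim
    case (elim t)
    have "t * norm k' = norm ((k t - k 0) - ((k t - k 0) - t *\<^sub>R k'))" using elim by simp
    also have "\<dots> \<le> norm (k t - k 0) + norm ((k t - k 0) - t *\<^sub>R k')" by (rule norm_triangle_ineq4)
    also have "\<dots> \<le> t * c t + norm ((k t - k 0) - t *\<^sub>R k')" using elim by simp
    finally have "norm k' \<le> (t * c t + norm ((k t - k 0) - t *\<^sub>R k')) / t"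
      using elim by (simp add: pos_le_divide_eq mult.commute)
    also have "\<dots> = c t + norm (((k t - k 0) - (t - 0) *\<^sub>R k') /\<^sub>R norm (t - 0))"
      using elim unfolding norm_scaleR by (simp add: field_simps)
    finally show ?case .
  qed
  then show ?thesis
    by (rule tendsto_lowerbound[OF lim]) simp
qed

text \<open>\<open>H\<close> is not known to be continuous, so the argument uses only
  differentiability of \<open>G\<close> at the point \<open>x\<close>. The second difference
  \<open>?D v w t\<close> is symmetric in \<open>v\<close> and \<open>w\<close>, and the mean value
  theorem in the direction \<open>v\<close> identifies it with t^2 times
  \<open>(H x *v w) \<bullet> v\<close> up to o(t^2).\<close>

lemma hessian_symmetric:
  assumes gh: "grad_hess_on S f G H" and x: "x \<in> S"
  shows "(H x *v v) \<bullet> w = (H x *v w) \<bullet> v"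
proof -
  have S: "open S" using gh by (simp add: grad_hess_on_def)
  let ?D = "\<lambda>v w t. f (x + t *\<^sub>R v + t *\<^sub>R w) - f (x + t *\<^sub>R v) - f (x + t *\<^sub>R w) + f x"
  have key: "\<exists>d>0. \<forall>t. 0 < t \<and> t < d \<longrightarrow> \<bar>?D v w t - t\<^sup>2 * ((H x *v w) \<bullet> v)\<bar> \<le> t\<^sup>2 * \<epsilon>"
    if \<epsilon>: "\<epsilon> > 0" for v w \<epsilon>
  proof -
    \<comment> \<open>The linearisation errors of \<open>G\<close> at the two points used below add
      up to \<open>2 * norm v + norm w\<close>, and pairing with \<open>v\<close> costs
      \<open>norm v\<close>. The added ones keep \<open>C\<close> positive.\<close>
    define C where "C = (2 * norm v + norm w + 1) * (norm v + 1)"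
    have C: "C > 0" unfolding C_def by (intro mult_pos_pos add_nonneg_pos add_nonneg_nonneg) auto
    define \<delta> where "\<delta> = \<epsilon> / C"
    have \<delta>: "\<delta> > 0" using \<epsilon> C by (simp add: \<delta>_def)
    have "(G has_derivative (\<lambda>h. H x *v h)) (at x)" using gh x by (auto simp: grad_hess_on_def)
    then obtain r where r: "r > 0"
      "\<And>y. norm (y - x) < r \<Longrightarrow> norm (G y - G x - H x *v (y - x)) \<le> \<delta> * norm (y - x)"
      using \<delta> unfolding has_derivative_at_alt by blast
    obtain r' where r': "r' > 0" "ball x r' \<subseteq> S" using S x openE by blast
    define d where "d = min r r' / (norm v + norm w + 1)"
    have pos: "norm v + norm w + 1 > 0" by (intro add_nonneg_pos add_nonneg_nonneg) auto
    have "\<bar>?D v w t - t\<^sup>2 * ((H x *v w) \<bullet> v)\<bar> \<le> t\<^sup>2 * \<epsilon>" if t: "0 < t" "t < d" for t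
    proof -
      have td: "t * (norm v + norm w + 1) < min r r'"
        using t pos by (simp add: d_def pos_less_divide_eq)
      have small: "norm (s *\<^sub>R v + u *\<^sub>R w) < min r r'" "norm (s *\<^sub>R v + u *\<^sub>R w) \<le> t * norm v + t * norm w"
        if "s \<in> {0..t}" "u \<in> {0..t}" for s u
      proof -
        have "norm (s *\<^sub>R v + u *\<^sub>R w) \<le> s * norm v + u * norm w"
          using that norm_triangle_ineq[of "s *\<^sub>R v" "u *\<^sub>R w"] by simp
        also have "\<dots> \<le> t * norm v + t * norm w" using that by (intro add_mono mult_right_mono) auto
        finally show "norm (s *\<^sub>R v + u *\<^sub>R w) \<le> t * norm v + t * norm w" .
        with td t show "norm (s *\<^sub>R v + u *\<^sub>R w) < min r r'" by (simp add: algebra_simps)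
      qed
      \<comment> \<open>The expected value of the second difference is subtracted as a term linear
        in \<open>s\<close>, so that the derivative of \<open>?g\<close> is purely an error of
        linearisation.\<close>
      let ?g = "\<lambda>s. f (x + (s *\<^sub>R v + t *\<^sub>R w)) - f (x + (s *\<^sub>R v + 0 *\<^sub>R w)) - s * (t * ((H x *v w) \<bullet> v))"
      let ?g' = "\<lambda>s. (G (x + (s *\<^sub>R v + t *\<^sub>R w)) - G (x + (s *\<^sub>R v + 0 *\<^sub>R w)) - H x *v (t *\<^sub>R w)) \<bullet> v"
      have fd: "((\<lambda>s. f (x + (s *\<^sub>R v + u *\<^sub>R w))) has_real_derivative G (x + (s *\<^sub>R v + u *\<^sub>R w)) \<bullet> v) (at s)"
        if "s \<in> {0..t}" "u \<in> {0..t}" for s u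
      proof -
        have "x + (s *\<^sub>R v + u *\<^sub>R w) \<in> ball x r'"
          using small(1)[OF that] by (simp add: dist_norm del: scaleR_left_distrib) (metis norm_minus_cancel minus_add_distrib diff_conv_add_uminus)
        then have "(f has_derivative (\<lambda>h. G (x + (s *\<^sub>R v + u *\<^sub>R w)) \<bullet> h)) (at (x + (s *\<^sub>R v + u *\<^sub>R w)))"
          using gh r' by (auto simp: grad_hess_on_def)
        moreover have "((\<lambda>s. x + (s *\<^sub>R v + u *\<^sub>R w)) has_derivative (\<lambda>h. h *\<^sub>R v)) (at s)"
          by (auto intro!: derivative_eq_intros)
        ultimately have "((\<lambda>s. f (x + (s *\<^sub>R v + u *\<^sub>R w))) has_derivative (\<lambda>h. G (x + (s *\<^sub>R v + u *\<^sub>R w)) \<bullet> (h *\<^sub>R v))) (at s)"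
          using has_derivative_compose by blast
        then show ?thesis
          by (simp add: has_field_derivative_def mult.commute[of _ "G (x + (s *\<^sub>R v + u *\<^sub>R w)) \<bullet> v"])
      qed
      have "\<exists>s>0. s < t \<and> ?g t - ?g 0 = (t - 0) * ?g' s"
      proof (rule MVT2[OF t(1)])
        fix s assume s: "0 \<le> s" "s \<le> t"
        have "(?g has_real_derivative
            (G (x + (s *\<^sub>R v + t *\<^sub>R w)) \<bullet> v - G (x + (s *\<^sub>R v + 0 *\<^sub>R w)) \<bullet> v - t * ((H x *v w) \<bullet> v))) (at s)"
          using s t by (auto intro!: derivative_eq_intros fd simp del: scaleR_zero_left)
        then show "(?g has_real_derivative ?g' s) (at s)"
          by (simp add: inner_diff_left matrix_vector_mult_scaleR)
      qed
      then obtain s where s: "0 < s" "s < t" "?g t - ?g 0 = t * ?g' s" by auto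
      have eq: "?D v w t - t\<^sup>2 * ((H x *v w) \<bullet> v) = t * ?g' s"
        using s(3) by (simp add: add.assoc power2_eq_square)
      let ?y = "x + (s *\<^sub>R v + t *\<^sub>R w)" and ?z = "x + (s *\<^sub>R v + 0 *\<^sub>R w)"
      have y: "norm (G ?y - G x - H x *v (?y - x)) \<le> \<delta> * (t * norm v + t * norm w)"
        using r(2)[of ?y] small[of s t] s t \<delta>
        by (intro order_trans[OF r(2)] mult_left_mono) auto
      have z: "norm (G ?z - G x - H x *v (?z - x)) \<le> \<delta> * (t * norm v)"
        using r(2)[of ?z] small[of s 0] s t \<delta>
        by (intro order_trans[OF r(2)] mult_left_mono) (auto intro: mult_right_mono)
      have split: "G ?y - G ?z - H x *v (t *\<^sub>R w) = (G ?y - G x - H x *v (?y - x)) - (G ?z - G x - H x *v (?z - x))"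
        by (simp add: matrix_vector_right_distrib algebra_simps)
      have "norm (G ?y - G ?z - H x *v (t *\<^sub>R w)) \<le> \<delta> * (t * norm v + t * norm w) + \<delta> * (t * norm v)"
        unfolding split by (rule order_trans[OF norm_triangle_ineq4 add_mono[OF y z]])
      then have "norm (G ?y - G ?z - H x *v (t *\<^sub>R w)) \<le> \<delta> * t * (2 * norm v + norm w)"
        by (simp add: algebra_simps)
      then have "norm (G ?y - G ?z - H x *v (t *\<^sub>R w)) * norm v \<le> \<delta> * t * (2 * norm v + norm w) * norm v"
        by (rule mult_right_mono) simp
      also have "\<dots> \<le> \<delta> * t * C"
        unfolding C_def using \<delta> t by (simp add: mult.assoc) (intro mult_left_mono mult_mono, auto)
      also have "\<dots> = \<epsilon> * t" using C by (simp add: \<delta>_def)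
      finally have "\<bar>?g' s\<bar> \<le> \<epsilon> * t"
        using Cauchy_Schwarz_ineq2 order_trans by blast
      then have "t * \<bar>?g' s\<bar> \<le> t * (\<epsilon> * t)" using t by (intro mult_left_mono) auto
      then show ?thesis unfolding eq using t by (simp add: abs_mult power2_eq_square mult_ac)
    qed
    moreover have "d > 0" using r r' pos by (simp add: d_def)
    ultimately show ?thesis by blast
  qed
  show ?thesis
  proof (rule ccontr)
    assume ne: "\<not> ?thesis"
    define \<epsilon> where "\<epsilon> = \<bar>(H x *v v) \<bullet> w - (H x *v w) \<bullet> v\<bar> / 3"
    have \<epsilon>: "\<epsilon> > 0" using ne by (simp add: \<epsilon>_def)
    obtain d1 where d1: "d1 > 0" "\<And>t. 0 < t \<Longrightarrow> t < d1 \<Longrightarrow> \<bar>?D v w t - t\<^sup>2 * ((H x *v w) \<bullet> v)\<bar> \<le> t\<^sup>2 * \<epsilon>"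
      using key[OF \<epsilon>, of v w] by blast
    obtain d2 where d2: "d2 > 0" "\<And>t. 0 < t \<Longrightarrow> t < d2 \<Longrightarrow> \<bar>?D w v t - t\<^sup>2 * ((H x *v v) \<bullet> w)\<bar> \<le> t\<^sup>2 * \<epsilon>"
      using key[OF \<epsilon>, of w v] by blast
    define t where "t = min d1 d2 / 2"
    have t: "0 < t" "t < d1" "t < d2" using d1 d2 by (auto simp: t_def)
    have "?D v w t = ?D w v t" by (simp add: algebra_simps)
    then have "\<bar>t\<^sup>2 * ((H x *v v) \<bullet> w) - t\<^sup>2 * ((H x *v w) \<bullet> v)\<bar> \<le> t\<^sup>2 * \<epsilon> + t\<^sup>2 * \<epsilon>"
      using d1(2)[OF t(1,2)] d2(2)[OF t(1,3)] by linarith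
    then have "t\<^sup>2 * \<bar>(H x *v v) \<bullet> w - (H x *v w) \<bullet> v\<bar> \<le> t\<^sup>2 * (2 * \<epsilon>)"
      by (simp add: right_diff_distrib[symmetric] abs_mult mult_ac)
    then have "\<bar>(H x *v v) \<bullet> w - (H x *v w) \<bullet> v\<bar> \<le> 2 * \<epsilon>" using t by simp
    then show False using \<epsilon> by (simp add: \<epsilon>_def)
  qed
qed

text \<open>
  The difference of \<open>w\<close> and its reflection in the hyperplane through \<open>x\<close> orthogonal to \<open>e\<close> vanishes
  on that hyperplane, so on the half ball it is controlled by a quadratic barrier.
\<close>

lemma gradient_estimate:
  fixes w :: "real^'n \<Rightarrow> real" and m :: real
  assumes gh: "grad_hess_on S w G H" and cb: "cball x d \<subseteq> S" and d: "d > 0"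
    and m: "\<And>z. z \<in> cball x d \<Longrightarrow> \<bar>w z\<bar> \<le> m"
    and N: "\<And>z. z \<in> cball x d \<Longrightarrow> \<bar>trace (H z)\<bar> < N"
  shows "norm (G x) \<le> CARD('n) * m / d + N * d / 2"
proof (cases "G x = 0")
  case True
  have "m \<ge> 0" "N > 0" using m[of x] N[of x] d by auto
  with True d show ?thesis by simp
next
  case False
  define n where "n = real CARD('n)"
  have n: "n \<ge> 1" by (simp add: n_def Suc_leI)
  have m0: "m \<ge> 0" and N0: "N > 0" using m[of x] N[of x] d by auto
  define e where "e = G x /\<^sub>R norm (G x)"
  have e: "norm e = 1" "e \<bullet> e = 1" using False by (auto simp: e_def power2_norm_eq_inner[symmetric] power2_eq_square)
  define q where "q = (\<lambda>y. y - (2 * (e \<bullet> y)) *\<^sub>R e)"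
  have q: "orthogonal_transformation q"
    unfolding orthogonal_transformation_def
  proof
    show "linear q" unfolding q_def
      by (rule linearI) (auto simp: inner_simps algebra_simps)
    show "\<forall>v w. q v \<bullet> q w = v \<bullet> w"
      by (auto simp: q_def inner_simps e inner_commute algebra_simps)
  qed
  define b where "b = (2 * (e \<bullet> x)) *\<^sub>R e"
  have qb: "q z + b = z - (2 * (e \<bullet> (z - x))) *\<^sub>R e" for z
    by (simp add: q_def b_def inner_simps algebra_simps)
  have refl_cball: "q z + b \<in> cball x d \<longleftrightarrow> z \<in> cball x d" for z
  proof -
    have "q z + b - x = q (z - x)" by (simp add: qb) (simp add: q_def algebra_simps)
    then show ?thesis
      using orthogonal_transformation_norm[OF q, of "z - x"] by (simp add: dist_norm norm_minus_commute[of x])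
  qed
  \<comment> \<open>\<open>A\<close> makes the isotropic part equal to \<open>m\<close> on the
    sphere; \<open>C\<close> then brings the Laplacian of the barrier to \<open>- N\<close>.
    \<open>B = - C * d\<close> makes the one-dimensional part a multiple of s (d - s), where s is
    the coordinate along \<open>e\<close>; this is nonnegative on the half ball. The slope
    \<open>B\<close> at the centre is the asserted bound.\<close>
  define A B where "A = m / d\<^sup>2" and "B = n * m / d + N * d / 2"
  define C where "C = - (n * m / d\<^sup>2 + N / 2)"
  define \<psi> where "\<psi> = (\<lambda>z. A * ((z - x) \<bullet> (z - x)) + B * (e \<bullet> (z - x)) + C * (e \<bullet> (z - x))\<^sup>2 + 0)"
  define K where "K = cball x d \<inter> {z. e \<bullet> (z - x) \<ge> 0}"
  define U where "U = ball x d \<inter> {z. e \<bullet> (z - x) > 0}"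
  have "open {z. e \<bullet> (z - x) > 0}" by (intro open_Collect_less continuous_intros)
  then have U: "open U" "U \<subseteq> K" by (auto simp: U_def K_def)
  have "closed {z. e \<bullet> (z - x) \<ge> 0}" by (intro closed_Collect_le continuous_intros)
  then have K: "compact K" by (simp add: K_def compact_Int_closed)
  have tr: "trace ((2 * A) *\<^sub>R mat 1 + (2 * C) *\<^sub>R outer_square e :: real^'n^'n) = - N"
    unfolding trace_quadratic e by (simp add: A_def C_def n_def algebra_simps)
  have BC: "B * t + C * t\<^sup>2 = t * (d - t) * (n * m / d\<^sup>2 + N / 2)" for t
    using d by (simp add: B_def C_def field_simps power2_eq_square)
  \<comment> \<open>Half of the difference with the reflection is bounded by \<open>m\<close> and
    has Laplacian below \<open>N\<close> in absolute value, like \<open>w\<close> itself. The two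
    signs of \<open>s\<close> give a two-sided bound.\<close>
  have main: "\<psi> z + s * (w z - w (q z + b)) \<ge> 0" if z: "z \<in> K" and s: "\<bar>s\<bar> = 1/2" for z s
  proof (rule weak_minimum_principle[OF K _ _ z])
    have w: "continuous_on (cball x d) w"
      using gh cb by (auto simp: grad_hess_on_def intro!: has_derivative_continuous continuous_at_imp_continuous_on)
    have "continuous_on K (\<lambda>z. w (q z + b))"
      by (rule continuous_on_compose2[OF w])
        (use refl_cball in \<open>auto simp: qb K_def intro!: continuous_intros\<close>)
    moreover have "continuous_on K w" using w by (rule continuous_on_subset) (auto simp: K_def)
    moreover have "continuous_on K \<psi>" unfolding \<psi>_def by (intro continuous_intros)
    ultimately show "continuous_on K (\<lambda>z. \<psi> z + s * (w z - w (q z + b)))" by (intro continuous_intros)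
    fix y assume y: "y \<in> K"
    have half: "\<bar>s * (a - c)\<bar> \<le> M" if "\<bar>a\<bar> \<le> M" "\<bar>c\<bar> \<le> M" for a c M
    proof -
      have "\<bar>s * (a - c)\<bar> = \<bar>a - c\<bar> / 2" unfolding abs_mult s by simp
      also have "\<dots> \<le> M" using that abs_triangle_ineq4[of a c] by simp
      finally show ?thesis .
    qed
    consider "y \<in> U" | "e \<bullet> (y - x) = 0" | "norm (y - x) = d" "e \<bullet> (y - x) \<ge> 0"
      using y by (fastforce simp: K_def U_def dist_norm norm_minus_commute)
    then show "0 \<le> \<psi> y + s * (w y - w (q y + b)) \<or> (\<exists>S G H. grad_hess_on S (\<lambda>z. \<psi> z + s * (w z - w (q z + b))) G H \<and>
        y \<in> S \<and> S \<subseteq> K \<and> trace (H y) < 0)"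
    proof cases
      case 1
      have "grad_hess_on U w G H"
        using grad_hess_on_subset[OF gh U(1)] U(2) cb by (auto simp: K_def)
      moreover have "grad_hess_on U (\<lambda>x. w (q x + b)) (\<lambda>x. transpose (matrix q) *v G (q x + b))
         (\<lambda>x. transpose (matrix q) ** H (q x + b) ** matrix q)"
        by (rule grad_hess_on_subset[OF grad_hess_on_isometry[OF gh q] U(1)])
          (use U(2) cb refl_cball in \<open>unfold K_def, blast\<close>)
      moreover have "grad_hess_on U \<psi> (\<lambda>z. (2 * A) *\<^sub>R (z - x) + (B + 2 * C * (e \<bullet> (z - x))) *\<^sub>R e)
          (\<lambda>z. (2 * A) *\<^sub>R mat 1 + (2 * C) *\<^sub>R outer_square e)"
        unfolding \<psi>_def by (rule grad_hess_on_subset[OF grad_hess_on_quadratic U(1)]) simp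
      ultimately have "grad_hess_on U (\<lambda>z. \<psi> z + s * (w z - w (q z + b)))
          (\<lambda>z. ((2 * A) *\<^sub>R (z - x) + (B + 2 * C * (e \<bullet> (z - x))) *\<^sub>R e) + s *\<^sub>R (G z - transpose (matrix q) *v G (q z + b)))
          (\<lambda>z. ((2 * A) *\<^sub>R mat 1 + (2 * C) *\<^sub>R outer_square e) + s *\<^sub>R (H z - transpose (matrix q) ** H (q z + b) ** matrix q))"
        by (intro grad_hess_on_add grad_hess_on_cmult grad_hess_on_diff)
      moreover have "trace (((2 * A) *\<^sub>R mat 1 + (2 * C) *\<^sub>R outer_square e) +
          s *\<^sub>R (H y - transpose (matrix q) ** H (q y + b) ** matrix q)) < 0"
      proof -
        have "\<bar>trace (H y)\<bar> < N" "\<bar>trace (H (q y + b))\<bar> < N"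
          using N[of y] N[of "q y + b"] y refl_cball[of y] by (auto simp: K_def simp del: mem_cball)
        then have "\<bar>trace (H y) - trace (H (q y + b))\<bar> / 2 < N"
          using abs_triangle_ineq4[of "trace (H y)" "trace (H (q y + b))"] by simp
        moreover have "\<bar>s * (trace (H y) - trace (H (q y + b)))\<bar> = \<bar>trace (H y) - trace (H (q y + b))\<bar> / 2"
          unfolding abs_mult s by simp
        ultimately have "\<bar>s * (trace (H y) - trace (H (q y + b)))\<bar> < N" by (simp only:)
        then show ?thesis
          unfolding trace_add[of _ "s *\<^sub>R _"] tr trace_scaleR trace_sub trace_orthogonal_conjugate[OF q] by linarith
      qed
      ultimately show ?thesis using 1 U(2) by blast
    next
      case 2
      then have "q y + b = y" by (simp add: qb)
      moreover have "\<psi> y \<ge> 0" using 2 m0 by (simp add: \<psi>_def A_def)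
      ultimately show ?thesis by simp
    next
      case 3
      have "e \<bullet> (y - x) \<le> d" using norm_cauchy_schwarz[of e "y - x"] e 3 by simp
      then have "B * (e \<bullet> (y - x)) + C * (e \<bullet> (y - x))\<^sup>2 \<ge> 0"
        unfolding BC using 3 n m0 N0 d by (intro mult_nonneg_nonneg) auto
      moreover have "A * ((y - x) \<bullet> (y - x)) = m"
        using 3 d by (simp add: A_def power2_norm_eq_inner[symmetric])
      ultimately have "\<psi> y \<ge> m" by (simp add: \<psi>_def)
      moreover have "\<bar>s * (w y - w (q y + b))\<bar> \<le> m"
        using m[of y] m[of "q y + b"] y refl_cball[of y] by (intro half) (auto simp: K_def simp del: mem_cball)
      ultimately show ?thesis by linarith
    qed
  qed
  \<comment> \<open>On the line through \<open>x\<close> along \<open>e\<close> the reflection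
    exchanges the two points, so \<open>main\<close> bounds this symmetric difference. Its
    derivative at 0 is twice the derivative of \<open>w\<close> along the gradient
    direction.\<close>
  define k where "k = (\<lambda>t. w (x + t *\<^sub>R e) - w (x - t *\<^sub>R e))"
  have "norm (2 * (G x \<bullet> e)) \<le> 2 * B"
  proof (rule norm_vector_derivative_le)
    have "x \<in> S" using cb d by (intro subsetD[OF cb]) simp
    then have wd: "(w has_derivative (\<lambda>h. G x \<bullet> h)) (at x)" using gh by (auto simp: grad_hess_on_def)
    have pd: "((\<lambda>t. x + t *\<^sub>R e) has_derivative (\<lambda>h. h *\<^sub>R e)) (at 0)"
      and md: "((\<lambda>t. x - t *\<^sub>R e) has_derivative (\<lambda>h. - (h *\<^sub>R e))) (at 0)"
      by (auto intro!: derivative_eq_intros)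
    have "((\<lambda>t. w (x + t *\<^sub>R e)) has_derivative (\<lambda>h. G x \<bullet> (h *\<^sub>R e))) (at 0)"
      by (rule has_derivative_compose[OF pd]) (simp add: wd)
    moreover have "((\<lambda>t. w (x - t *\<^sub>R e)) has_derivative (\<lambda>h. G x \<bullet> (- (h *\<^sub>R e)))) (at 0)"
      by (rule has_derivative_compose[OF md]) (simp add: wd)
    ultimately have "(k has_derivative (\<lambda>h. G x \<bullet> (h *\<^sub>R e) - G x \<bullet> (- (h *\<^sub>R e)))) (at 0)"
      unfolding k_def by (rule has_derivative_diff)
    then show "(k has_vector_derivative 2 * (G x \<bullet> e)) (at 0)"
      unfolding has_vector_derivative_def by (rule has_derivative_eq_rhs) (simp add: fun_eq_iff)
    show "((\<lambda>t. 2 * B) \<longlongrightarrow> 2 * B) (at_right 0)" by simp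
    have "\<forall>\<^sub>F t in at_right 0. t \<in> {0<..<d}" using eventually_at_right_real[OF d] .
    then show "\<forall>\<^sub>F t in at_right 0. norm (k t - k 0) \<le> t * (2 * B)"
    proof eventually_elim
      case (elim t)
      let ?z = "x + t *\<^sub>R e"
      have z: "?z \<in> K" using elim e d by (simp add: K_def dist_norm)
      have "\<psi> ?z = A * t\<^sup>2 + (B * t + C * t\<^sup>2)" using e by (simp add: \<psi>_def power2_eq_square mult_ac)
      also have "\<dots> = t * B + t\<^sup>2 * (A - n * m / d\<^sup>2 - N / 2)" by (simp add: C_def algebra_simps)
      also have "\<dots> \<le> t * B"
      proof -
        have "A \<le> n * m / d\<^sup>2" unfolding A_def using n m0 by (intro divide_right_mono) (auto simp: mult_le_cancel_right1)
        then show ?thesis using N0 by (simp add: mult_nonneg_nonpos)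
      qed
      finally have "\<psi> ?z \<le> t * B" .
      moreover have refl: "q ?z + b = x - t *\<^sub>R e"
      proof -
        have "q ?z + b = ?z - (2 * t) *\<^sub>R e" using e unfolding qb by simp
        also have "\<dots> = x - t *\<^sub>R e"
          by (simp only: mult_2 scaleR_add_left diff_diff_eq[symmetric] add_diff_cancel_right')
        finally show ?thesis .
      qed
      moreover have "\<psi> ?z + 1/2 * (w ?z - w (x - t *\<^sub>R e)) \<ge> 0"
        using main[OF z, of "1/2"] unfolding refl by simp
      moreover have "\<psi> ?z + (-1/2) * (w ?z - w (x - t *\<^sub>R e)) \<ge> 0"
        using main[OF z, of "-1/2"] unfolding refl by simp
      ultimately have "k t \<le> 2 * (t * B)" "- k t \<le> 2 * (t * B)"
        unfolding k_def by argo+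
      then have "\<bar>k t\<bar> \<le> 2 * (t * B)" by (rule abs_leI)
      then show ?case by (simp add: k_def)
    qed
  qed
  moreover have "G x \<bullet> e = norm (G x)"
    using False by (simp add: e_def power2_norm_eq_inner[symmetric] power2_eq_square)
  ultimately show ?thesis by (simp add: B_def n_def)
qed

subsection \<open>Lipschitz solutions of the eigenvalue equation\<close>

lemma one_minus_sqrt_le:
  fixes s :: real
  assumes "\<bar>s\<bar> \<le> 1"
  shows "\<bar>sqrt (1 - s\<^sup>2) - 1\<bar> \<le> s\<^sup>2"
proof -
  have s: "0 \<le> s\<^sup>2" "s\<^sup>2 \<le> 1" using assms by (auto simp: abs_square_le_1)
  have "(1 - s\<^sup>2)\<^sup>2 \<le> 1 - s\<^sup>2" unfolding power2_eq_square[of "1 - s\<^sup>2"]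
    using s mult_left_le[of "1 - s\<^sup>2" "1 - s\<^sup>2"] by simp
  then have "1 - s\<^sup>2 \<le> sqrt (1 - s\<^sup>2)" by (rule real_le_rsqrt)
  moreover have "sqrt (1 - s\<^sup>2) \<le> 1" using s by simp
  ultimately show ?thesis by linarith
qed

text \<open>
  A rotation in the plane spanned by \<open>\<nu>\<close> and \<open>b\<close>, with \<open>norm b * t\<close> as the sine of the angle, so that
  the first-order term in \<open>t\<close> is exact.
\<close>

lemma rotation_exists:
  fixes \<nu> b :: "real^'n"
  assumes \<nu>: "norm \<nu> = 1" and b: "\<nu> \<bullet> b = 0" "norm b \<le> K" and t: "0 \<le> t" "K * t \<le> 1"
  shows "\<exists>q. orthogonal_transformation q \<and>
    (\<forall>v. norm (q v - v - t *\<^sub>R ((\<nu> \<bullet> v) *\<^sub>R b - (b \<bullet> v) *\<^sub>R \<nu>)) \<le> 2 * (K * t)\<^sup>2 * norm v)"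
proof (cases "b = 0")
  case True
  then show ?thesis
    by (intro exI[of _ "\<lambda>v. v"]) auto
next
  case False
  define \<beta> where "\<beta> = b /\<^sub>R norm b"
  have \<nu>\<nu>: "\<nu> \<bullet> \<nu> = 1" using \<nu> by (simp add: norm_eq_1)
  have \<beta>: "norm \<beta> = 1" using False by (simp add: \<beta>_def)
  have \<beta>\<beta>: "\<beta> \<bullet> \<beta> = 1" using \<beta> by (simp add: norm_eq_1)
  have \<nu>\<beta>: "\<nu> \<bullet> \<beta> = 0" "\<beta> \<bullet> \<nu> = 0" using b by (auto simp: \<beta>_def inner_commute)
  have b\<beta>: "b = norm b *\<^sub>R \<beta>" using False by (simp add: \<beta>_def)
  define s where "s = norm b * t"
  have "norm b * t \<le> K * t" using b t by (intro mult_right_mono) auto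
  then have s: "0 \<le> s" "s \<le> K * t" "s \<le> 1" using t by (auto simp: s_def)
  \<comment> \<open>Cosine minus one, when \<open>s\<close> is the sine. It is O(s^2) and is the
    whole error of the first-order approximation.\<close>
  define c where "c = sqrt (1 - s\<^sup>2) - 1"
  have "s\<^sup>2 \<le> 1" using s by (simp add: power_le_one)
  then have c2: "(c + 1)\<^sup>2 = 1 - s\<^sup>2" by (simp add: c_def)
  have cs: "\<bar>c\<bar> \<le> s\<^sup>2" using one_minus_sqrt_le[of s] s by (simp add: c_def)
  define q where "q v = v + (c * (\<nu> \<bullet> v) - s * (\<beta> \<bullet> v)) *\<^sub>R \<nu> + (c * (\<beta> \<bullet> v) + s * (\<nu> \<bullet> v)) *\<^sub>R \<beta>" for v
  have "orthogonal_transformation q"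
    unfolding orthogonal_transformation
  proof
    show "linear q" unfolding q_def by (rule linearI) (auto simp: inner_simps algebra_simps)
    show "\<forall>v. norm (q v) = norm v"
    proof
      fix v
      define x y where "x = \<nu> \<bullet> v" and "y = \<beta> \<bullet> v"
      have "q v \<bullet> q v = v \<bullet> v + 2 * (c * x - s * y) * x + 2 * (c * y + s * x) * y + (c * x - s * y)\<^sup>2 + (c * y + s * x)\<^sup>2"
        unfolding q_def x_def[symmetric] y_def[symmetric]
        by (simp add: inner_add_left inner_add_right \<nu>\<nu> \<beta>\<beta> \<nu>\<beta> inner_commute[of v \<nu>] inner_commute[of v \<beta>] x_def[symmetric] y_def[symmetric] power2_eq_square)
          (simp add: algebra_simps)
      also have "\<dots> = v \<bullet> v + ((c + 1)\<^sup>2 - 1 + s\<^sup>2) * (x\<^sup>2 + y\<^sup>2)"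
        by (simp add: power2_eq_square algebra_simps)
      also have "\<dots> = v \<bullet> v" by (simp add: c2)
      finally show "norm (q v) = norm v" by (simp add: norm_eq)
    qed
  qed
  moreover have "norm (q v - v - t *\<^sub>R ((\<nu> \<bullet> v) *\<^sub>R b - (b \<bullet> v) *\<^sub>R \<nu>)) \<le> 2 * (K * t)\<^sup>2 * norm v" for v
  proof -
    have "t *\<^sub>R ((\<nu> \<bullet> v) *\<^sub>R b - (b \<bullet> v) *\<^sub>R \<nu>) = (s * (\<nu> \<bullet> v)) *\<^sub>R \<beta> - (s * (\<beta> \<bullet> v)) *\<^sub>R \<nu>"
      by (subst (1 2) b\<beta>) (simp add: s_def scaleR_diff_right mult_ac)
    then have "q v - v - t *\<^sub>R ((\<nu> \<bullet> v) *\<^sub>R b - (b \<bullet> v) *\<^sub>R \<nu>) = c *\<^sub>R ((\<nu> \<bullet> v) *\<^sub>R \<nu> + (\<beta> \<bullet> v) *\<^sub>R \<beta>)"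
      by (simp add: q_def algebra_simps)
    moreover have "norm ((\<nu> \<bullet> v) *\<^sub>R \<nu> + (\<beta> \<bullet> v) *\<^sub>R \<beta>) \<le> norm v + norm v"
      using Cauchy_Schwarz_ineq2[of \<nu> v] Cauchy_Schwarz_ineq2[of \<beta> v] \<nu> \<beta>
      by (intro norm_triangle_le) auto
    then have "\<bar>c\<bar> * norm ((\<nu> \<bullet> v) *\<^sub>R \<nu> + (\<beta> \<bullet> v) *\<^sub>R \<beta>) \<le> (K * t)\<^sup>2 * (norm v + norm v)"
      using cs s by (intro mult_mono order_trans[OF cs] power_mono) auto
    ultimately show ?thesis by simp
  qed
  ultimately show ?thesis by blast
qed

text \<open>\<open>u\<close> lives on the whole space, although the equation holds only in
  \<open>S\<close>: a rigid motion may carry points across the boundary, and the global Lipschitz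
  bound still compares the values there.\<close>

locale lipschitz_eigenfunction =
  fixes S :: "(real^'n) set" and u G H and M lam :: real
  assumes gh: "grad_hess_on S u G H"
    and M: "M > 0" and lam: "lam > 0"
    and lipschitz: "\<And>x y. \<bar>u x - u y\<bar> \<le> M * norm (x - y)"
    and outside: "\<And>x. x \<notin> S \<Longrightarrow> u x = 0"
    and eigen: "\<And>x. x \<in> S \<Longrightarrow> trace (H x) = - lam * u x"
    and grad_le: "\<And>x. x \<in> S \<Longrightarrow> norm (G x) \<le> M"
begin

text \<open>The difference w of the moved copy and \<open>u\<close> satisfies the eigenvalue
  equation, so its Laplacian is at most \<open>lam * m\<close>, doubled below to obtain a strict
  bound. By \<open>lam * d^2 \<le> 1\<close> this contributes no more than the sup norm does. The
  gradient of the moved copy is \<open>G\<close> turned back by the inverse of \<open>q\<close>; the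
  last summand pays for undoing this turn.\<close>

lemma gradient_difference_le:
  fixes d m :: real
  assumes q: "orthogonal_transformation q" and d: "d > 0" "lam * d\<^sup>2 \<le> 1" "m > 0"
    and cb: "cball x d \<subseteq> S" "\<And>z. z \<in> cball x d \<Longrightarrow> q z + b \<in> S"
    and m: "\<And>z. z \<in> cball x d \<Longrightarrow> \<bar>u (q z + b) - u z\<bar> \<le> m"
  shows "norm (G (q x + b) - G x) \<le> 2 * CARD('n) * m / d + norm (q (G x) - G x)"
proof -
  let ?T = "S \<inter> {x. q x + b \<in> S}"
  have "open {x. q x + b \<in> S}" using grad_hess_on_isometry[OF gh q, of b] by (simp add: grad_hess_on_def)
  then have T: "open ?T" using gh by (auto simp: grad_hess_on_def)
  have g1: "grad_hess_on ?T u G H" by (rule grad_hess_on_subset[OF gh T]) simp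
  have g2: "grad_hess_on ?T (\<lambda>x. u (q x + b)) (\<lambda>x. transpose (matrix q) *v G (q x + b))
     (\<lambda>x. transpose (matrix q) ** H (q x + b) ** matrix q)"
    by (rule grad_hess_on_subset[OF grad_hess_on_isometry[OF gh q] T]) simp
  have "norm (transpose (matrix q) *v G (q x + b) - G x) \<le> CARD('n) * m / d + (2 * lam * m) * d / 2"
  proof (rule gradient_estimate[OF grad_hess_on_diff[OF g2 g1] _ d(1) m])
    show "cball x d \<subseteq> ?T" using cb by auto
    fix z assume z: "z \<in> cball x d"
    have "trace (transpose (matrix q) ** H (q z + b) ** matrix q - H z) = - lam * (u (q z + b) - u z)"
      using z cb eigen by (auto simp: trace_sub trace_orthogonal_conjugate[OF q] algebra_simps subset_iff)
    then have "\<bar>trace (transpose (matrix q) ** H (q z + b) ** matrix q - H z)\<bar> = lam * \<bar>u (q z + b) - u z\<bar>"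
      using lam by (simp add: abs_mult)
    also have "\<dots> \<le> lam * m" using m[OF z] lam by (intro mult_left_mono) auto
    also have "\<dots> < 2 * lam * m" using lam d by simp
    finally show "\<bar>trace (transpose (matrix q) ** H (q z + b) ** matrix q - H z)\<bar> < 2 * lam * m" .
  qed
  also have "\<dots> = (CARD('n) + lam * d\<^sup>2) * m / d" using d by (simp add: field_simps power2_eq_square)
  also have "\<dots> \<le> (CARD('n) + CARD('n)) * m / d"
  proof -
    have "1 \<le> real CARD('n)" by (simp add: Suc_leI)
    then have "CARD('n) + lam * d\<^sup>2 \<le> real CARD('n) + CARD('n)" using d by linarith
    then show ?thesis using d by (intro divide_right_mono mult_right_mono) auto
  qed
  finally have *: "norm (transpose (matrix q) *v G (q x + b) - G x) \<le> 2 * CARD('n) * m / d" by simp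
  have "q (transpose (matrix q) *v G (q x + b) - G x) = G (q x + b) - q (G x)"
    using q orthogonal_transformation_adjoint(2)[OF q]
    by (simp add: linear_diff orthogonal_transformation_linear del: transpose_matrix_vector)
  then have "norm (G (q x + b) - q (G x)) \<le> 2 * CARD('n) * m / d"
    using * orthogonal_transformation_norm[OF q] by metis
  then show ?thesis
    using norm_triangle_ineq[of "G (q x + b) - q (G x)" "q (G x) - G x"] by simp
qed

lemma norm_hessian_le:
  assumes \<gamma>: "(\<gamma> has_vector_derivative T) (at 0)" "\<gamma> 0 \<in> S"
    and le: "\<forall>\<^sub>F t in at_right 0. norm (G (\<gamma> t) - G (\<gamma> 0)) \<le> t * c t" "(c \<longlongrightarrow> l) (at_right 0)"
  shows "norm (H (\<gamma> 0) *v T) \<le> l"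
proof (rule norm_vector_derivative_le[of "\<lambda>t. G (\<gamma> t)", OF _ le])
  have "(G has_derivative (\<lambda>h. H (\<gamma> 0) *v h)) (at (\<gamma> 0))" using gh \<gamma> by (auto simp: grad_hess_on_def)
  from has_derivative_compose[OF \<gamma>(1)[unfolded has_vector_derivative_def] this]
  show "((\<lambda>t. G (\<gamma> t)) has_vector_derivative H (\<gamma> 0) *v T) (at 0)"
    by (simp add: has_vector_derivative_def matrix_vector_mult_scaleR)
qed

text \<open>Translations suffice here. On the ball of radius \<open>d / 2\<close> a short translate
  stays in \<open>S\<close>, and the Lipschitz bound controls the difference.\<close>

lemma interior_hessian_le:
  assumes d: "d > 0" "lam * d\<^sup>2 \<le> 1" and b: "ball x d \<subseteq> S"
  shows "norm (H x *v e) \<le> 4 * CARD('n) * M / d * norm e"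
proof (cases "e = 0")
  case True
  then show ?thesis by (simp add: matrix_vector_mult_0_right)
next
  case False
  have xS: "x \<in> S" using b d by auto
  have "norm (H (x + 0 *\<^sub>R e) *v e) \<le> 4 * CARD('n) * M / d * norm e"
  proof (rule norm_hessian_le)
    show "((\<lambda>t. x + t *\<^sub>R e) has_vector_derivative e) (at 0)"
      unfolding has_vector_derivative_def by (auto intro!: derivative_eq_intros)
    show "x + 0 *\<^sub>R e \<in> S" using xS by simp
    show "((\<lambda>t. 4 * CARD('n) * M / d * norm e) \<longlongrightarrow> 4 * CARD('n) * M / d * norm e) (at_right 0)" by simp
    have "\<forall>\<^sub>F t in at_right 0. t \<in> {0<..<d / 2 / norm e}"
      by (rule eventually_at_right_real) (use False d in simp)
    then show "\<forall>\<^sub>F t in at_right 0. norm (G (x + t *\<^sub>R e) - G (x + 0 *\<^sub>R e)) \<le> t * (4 * CARD('n) * M / d * norm e)"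
    proof eventually_elim
      case (elim t)
      have te: "norm (t *\<^sub>R e) < d / 2" "t > 0" using elim False by (auto simp: field_simps)
      have "norm (G (x + t *\<^sub>R e) - G x) \<le> 2 * CARD('n) * (M * norm (t *\<^sub>R e)) / (d / 2) + norm (G x - G x)"
      proof (rule gradient_difference_le[of "\<lambda>v. v" "d / 2" "M * norm (t *\<^sub>R e)" x "t *\<^sub>R e"])
        show "orthogonal_transformation (\<lambda>v::real^'n. v)" by (rule orthogonal_transformation_id)
        have "lam * (d / 2)\<^sup>2 \<le> lam * d\<^sup>2" using lam d by (intro mult_left_mono power_mono) auto
        then show "lam * (d / 2)\<^sup>2 \<le> 1" using d by linarith
        show "cball x (d / 2) \<subseteq> S" using b d by (auto simp: subset_iff)
        show "z + t *\<^sub>R e \<in> S" if "z \<in> cball x (d / 2)" for z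
        proof (rule subsetD[OF b])
          have "norm (x - (z + t *\<^sub>R e)) \<le> norm (x - z) + norm (t *\<^sub>R e)"
            using norm_triangle_ineq4[of "x - z" "t *\<^sub>R e"] by (simp add: algebra_simps)
          also have "\<dots> < d" using that te by (simp add: dist_norm)
          finally show "z + t *\<^sub>R e \<in> ball x d" by (simp add: dist_norm)
        qed
        show "\<bar>u (z + t *\<^sub>R e) - u z\<bar> \<le> M * norm (t *\<^sub>R e)" for z
          using lipschitz[of "z + t *\<^sub>R e" z] by simp
      qed (use d M False te in auto)
      then show ?case using te d by (simp add: field_simps)
    qed
  qed
  then show ?thesis by simp
qed

end

subsection \<open>Barrier at a boundary point\<close>

text \<open>
  The chart is normalised so that \<open>g p\<close> is the outer unit normal at \<open>p\<close>; \<open>g\<close> and \<open>B\<close> play the roles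
  of the gradient of \<open>\<rho>\<close> and of its Hessian at \<open>p\<close>, and \<open>K\<close> bounds everything.
\<close>

definition boundary_chart ::
  "(real^'n) set \<Rightarrow> real \<Rightarrow> real^'n \<Rightarrow> (real^'n \<Rightarrow> real) \<Rightarrow> (real^'n \<Rightarrow> real^'n) \<Rightarrow> real^'n^'n \<Rightarrow> bool"
  where "boundary_chart \<Omega> K p \<rho> g B \<longleftrightarrow>
    continuous_on (ball p (1 / K)) \<rho> \<and>
    (\<forall>x\<in>ball p (1 / K). x \<in> \<Omega> \<longleftrightarrow> \<rho> x \<le> 0) \<and> \<rho> p = 0 \<and> norm (g p) = 1 \<and>
    (\<forall>x\<in>ball p (1 / K). \<forall>y\<in>ball p (1 / K). \<bar>\<rho> y - \<rho> x - g x \<bullet> (y - x)\<bar> \<le> K * (norm (y - x))\<^sup>2) \<and>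
    (\<forall>x\<in>ball p (1 / K). norm (g x - g p - B *v (x - p)) \<le> K * (norm (x - p))\<^sup>2) \<and>
    (\<forall>v. norm (B *v v) \<le> K * norm v)"

text \<open>The second condition on \<open>r\<close> gives \<open>K * r \<le> 1 / 16\<close>, which
  tames the chart errors in the ball of radius \<open>r\<close>. The dimension in it is for the
  barrier, whose normal coefficient grows with the dimension.\<close>

locale boundary_point = lipschitz_eigenfunction S u G H M lam
  for S :: "(real^'n) set" and u G H M lam +
  fixes \<Omega> :: "(real^'n) set" and p and K :: real and \<rho> g B and r :: real and e :: "real^'n"
  assumes chart: "boundary_chart \<Omega> K p \<rho> g B"
    and S: "S = interior \<Omega>" and \<Omega>: "compact \<Omega>"
    and K: "K \<ge> 1" and r: "r > 0" "16 * CARD('n) * K * r \<le> 1" "lam * r\<^sup>2 \<le> 1"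
    and e: "norm e \<le> 1" "g p \<bullet> e = 0"
begin

text \<open>Linearising \<open>g x \<bullet> (e + A (x - p))\<close> at \<open>p\<close> gives
  \<open>(B *v X) \<bullet> e + g p \<bullet> A X\<close> with X = x - p. For tangential X the first
  term is X paired with the tangential part \<open>b\<close> of \<open>transpose B *v e\<close>, and
  the antisymmetric map \<open>A\<close>, a rotation in the plane of \<open>g p\<close> and
  \<open>b\<close>, is made to contribute the opposite.\<close>

definition "b = transpose B *v e - (g p \<bullet> (transpose B *v e)) *\<^sub>R g p"

definition "A v = (g p \<bullet> v) *\<^sub>R b - (b \<bullet> v) *\<^sub>R g p"

lemma Kr: "K * r \<le> 1 / 16"
proof -
  have "16 * (K * r) * 1 \<le> 16 * (K * r) * real CARD('n)"
    using K r by (intro mult_left_mono) (auto simp: Suc_leI)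
  then show ?thesis using r by (simp add: mult_ac)
qed

lemma normal: "norm (g p) = 1" "g p \<bullet> g p = 1"
  using chart by (auto simp: boundary_chart_def norm_eq_1)

lemma in_chart: "K * norm (x - p) < 1 \<Longrightarrow> x \<in> ball p (1 / K)"
  using K by (simp add: dist_norm norm_minus_commute field_simps)

lemma near: "norm (x - p) \<le> r \<Longrightarrow> K * norm (x - p) \<le> 1 / 16"
  using Kr K mult_left_mono[of "norm (x - p)" r K] by linarith

lemma B_le: "norm (B *v v) \<le> K * norm v"
  using chart by (simp add: boundary_chart_def)

lemma b: "g p \<bullet> b = 0" "norm b \<le> K"
proof -
  let ?c = "transpose B *v e"
  show "g p \<bullet> b = 0" by (simp add: b_def inner_diff_right normal)
  have "norm ?c * norm ?c = e \<bullet> (B *v ?c)"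
    by (metis dot_lmul_matrix transpose_matrix_vector power2_norm_eq_inner power2_eq_square)
  also have "\<dots> \<le> norm e * norm (B *v ?c)" by (rule norm_cauchy_schwarz)
  also have "\<dots> \<le> 1 * (K * norm ?c)"
    using chart e by (intro mult_mono) (auto simp: boundary_chart_def simp del: transpose_matrix_vector)
  finally have c: "norm ?c \<le> K" using K by (cases "norm ?c = 0") auto
  have "b \<bullet> b = ?c \<bullet> ?c - (g p \<bullet> ?c)\<^sup>2"
    by (simp add: b_def inner_diff_left inner_diff_right normal power2_eq_square inner_commute del: transpose_matrix_vector)
  then have "(norm b)\<^sup>2 \<le> (norm ?c)\<^sup>2" by (simp add: power2_norm_eq_inner del: transpose_matrix_vector)
  then have "norm b \<le> norm ?c" by (rule power2_le_imp_le) simp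
  then show "norm b \<le> K" using c by linarith
qed

lemma norm_A_le: "norm (A v) \<le> 2 * K * norm v"
proof -
  have "\<bar>g p \<bullet> v\<bar> * norm b \<le> norm v * K"
    using Cauchy_Schwarz_ineq2[of "g p" v] normal b by (intro mult_mono) auto
  moreover have "\<bar>b \<bullet> v\<bar> \<le> K * norm v"
    using Cauchy_Schwarz_ineq2[of b v] mult_right_mono[OF b(2), of "norm v"] by simp
  moreover have "norm (A v) \<le> \<bar>g p \<bullet> v\<bar> * norm b + \<bar>b \<bullet> v\<bar>"
    unfolding A_def using norm_triangle_ineq4[of "(g p \<bullet> v) *\<^sub>R b" "(b \<bullet> v) *\<^sub>R g p"] normal by simp
  ultimately show ?thesis by (simp add: mult_ac)
qed

lemma norm_tangent_le: "norm (x - p) \<le> r \<Longrightarrow> norm (e + A (x - p)) \<le> 2"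
  using norm_triangle_ineq[of e "A (x - p)"] norm_A_le[of "x - p"] near[of x] e by simp

lemma gradient_near_normal:
  assumes "K * norm (x - p) < 1"
  shows "norm (g x - g p) \<le> 2 * (K * norm (x - p))"
proof -
  have "norm (g x - g p - B *v (x - p)) \<le> K * (norm (x - p))\<^sup>2" "norm (B *v (x - p)) \<le> K * norm (x - p)"
    using chart in_chart[OF assms] by (auto simp: boundary_chart_def)
  moreover have "K * (norm (x - p))\<^sup>2 \<le> K * norm (x - p)"
  proof -
    have "norm (x - p) \<le> K * norm (x - p)" using K by (simp add: mult_le_cancel_right1)
    then have "norm (x - p) \<le> 1" using assms by linarith
    then show ?thesis using K by (simp add: power2_eq_square mult_left_le)
  qed
  ultimately show ?thesis
    using norm_triangle_ineq[of "g x - g p - B *v (x - p)" "B *v (x - p)"] by simp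
qed

text \<open>
  \<open>b\<close> is chosen so that the rigid motion with velocity \<open>e + A (x - p)\<close> is tangent to the boundary
  to second order at \<open>p\<close>.
\<close>

lemma tangency:
  assumes x: "norm (x - p) \<le> r"
  shows "\<bar>g x \<bullet> (e + A (x - p))\<bar> \<le> K * \<bar>g p \<bullet> (x - p)\<bar> + 4 * K\<^sup>2 * (norm (x - p))\<^sup>2"
proof -
  define X where "X = x - p"
  let ?c = "transpose B *v e"
  have "K * norm X < 1" using near[OF x] unfolding X_def by linarith
  then have "norm (g x - g p - B *v X) \<le> K * (norm X)\<^sup>2"
    using chart in_chart[of x] by (auto simp: boundary_chart_def X_def)
  then have "norm (g x - g p - B *v X) * norm (e + A X) \<le> K * (norm X)\<^sup>2 * 2"
    using norm_tangent_le[OF x] K by (intro mult_mono) (auto simp: X_def)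
  then have t1: "\<bar>(g x - g p - B *v X) \<bullet> (e + A X)\<bar> \<le> K * (norm X)\<^sup>2 * 2"
    using Cauchy_Schwarz_ineq2 order_trans by blast
  have "norm (B *v X) * norm (A X) \<le> (K * norm X) * (2 * K * norm X)"
    using chart norm_A_le K by (intro mult_mono) (auto simp: boundary_chart_def)
  then have t2: "\<bar>(B *v X) \<bullet> A X\<bar> \<le> 2 * K\<^sup>2 * (norm X)\<^sup>2"
    using order_trans[OF Cauchy_Schwarz_ineq2[of "B *v X" "A X"]] by (simp add: power2_eq_square mult_ac)
  have c: "?c = b + (g p \<bullet> ?c) *\<^sub>R g p" by (simp add: b_def)
  have adj: "(B *v v) \<bullet> e = ?c \<bullet> v" for v
    by (metis dot_lmul_matrix inner_commute transpose_matrix_vector)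
  have cn: "\<bar>g p \<bullet> ?c\<bar> \<le> K"
  proof -
    have "g p \<bullet> ?c = (B *v g p) \<bullet> e" unfolding adj by (rule inner_commute)
    moreover have "norm (B *v g p) * norm e \<le> K * 1"
      using B_le[of "g p"] e normal K by (intro mult_mono) auto
    ultimately show ?thesis using order_trans[OF Cauchy_Schwarz_ineq2[of "B *v g p" e]] by simp
  qed
  \<comment> \<open>The first-order terms now cancel except for a multiple of
    \<open>g p \<bullet> X\<close>, which on the boundary is itself quadratic in X.\<close>
  have "g p \<bullet> A X = - (b \<bullet> X)" using b(1) normal by (simp add: A_def inner_diff_right)
  moreover have "(B *v X) \<bullet> e = b \<bullet> X + (g p \<bullet> ?c) * (g p \<bullet> X)"
    unfolding adj by (subst c) (simp add: inner_add_left)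
  ultimately have "g x \<bullet> (e + A X) = (g x - g p - B *v X) \<bullet> (e + A X) + (B *v X) \<bullet> A X + (g p \<bullet> ?c) * (g p \<bullet> X)"
    using e by (simp add: inner_add_left inner_add_right inner_diff_left)
  moreover have "\<bar>(g p \<bullet> ?c) * (g p \<bullet> X)\<bar> \<le> K * \<bar>g p \<bullet> X\<bar>"
    unfolding abs_mult using cn by (intro mult_right_mono) auto
  moreover have "1 * (K * (norm X)\<^sup>2 * 2) \<le> K * (K * (norm X)\<^sup>2 * 2)"
    using K by (intro mult_right_mono) auto
  then have "K * (norm X)\<^sup>2 * 2 \<le> 2 * K\<^sup>2 * (norm X)\<^sup>2"
    by (simp add: power2_eq_square mult_ac)
  ultimately show ?thesis using t1 t2 unfolding X_def[symmetric] by linarith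
qed

lemma taylor:
  assumes "K * norm (x - p) < 1" "K * norm (y - p) < 1"
  shows "\<bar>\<rho> y - \<rho> x - g x \<bullet> (y - x)\<bar> \<le> K * (norm (y - x))\<^sup>2"
  using chart in_chart[OF assms(1)] in_chart[OF assms(2)] unfolding boundary_chart_def by blast

lemma normal_component:
  assumes "K * norm (x - p) < 1"
  shows "\<bar>\<rho> x - g p \<bullet> (x - p)\<bar> \<le> K * (norm (x - p))\<^sup>2"
proof -
  have "K * norm (p - p) < 1" using K by simp
  from taylor[OF this assms] show ?thesis using chart by (simp add: boundary_chart_def)
qed

lemma outside_nonneg:
  assumes "K * norm (x - p) < 1" "x \<notin> S"
  shows "\<rho> x \<ge> 0"
proof (rule ccontr)
  assume "\<not> \<rho> x \<ge> 0"
  then have "x \<in> {x \<in> ball p (1 / K). \<rho> x < 0}" using in_chart assms by auto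
  moreover have "open {x \<in> ball p (1 / K). \<rho> x < 0}"
  proof -
    have "open (ball p (1 / K) \<inter> \<rho> -` {..<0})"
      by (rule continuous_open_preimage) (use chart in \<open>auto simp: boundary_chart_def\<close>)
    then show ?thesis by (simp add: vimage_def Int_def)
  qed
  moreover have "{x \<in> ball p (1 / K). \<rho> x < 0} \<subseteq> \<Omega>" using chart by (auto simp: boundary_chart_def)
  ultimately have "x \<in> interior \<Omega>" using interiorI by blast
  then show False using S assms by simp
qed

text \<open>Walking a distance \<open>3 * \<delta>\<close> along the outer normal raises
  \<open>\<rho>\<close> by at least 9/4 \<delta> up to an error of 3/10 \<delta>. The walk therefore
  ends outside \<Omega>, where \<open>u\<close> vanishes, and the Lipschitz bound applies.\<close>

lemma collar:
  assumes y: "K * norm (y - p) \<le> 1 / 8" and \<delta>: "\<delta> > 0" "K * \<delta> \<le> 1 / 30" and le: "\<rho> y \<ge> - \<delta>"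
  shows "\<bar>u y\<bar> \<le> 3 * \<delta> * M"
proof -
  define z where "z = y + (3 * \<delta>) *\<^sub>R g p"
  have zy: "norm (z - y) = 3 * \<delta>" using \<delta> normal by (simp add: z_def)
  have "norm (z - p) \<le> norm (y - p) + 3 * \<delta>"
    using norm_triangle_ineq[of "y - p" "z - y"] zy by simp
  then have "K * norm (z - p) \<le> K * (norm (y - p) + 3 * \<delta>)" using K by (intro mult_left_mono) auto
  also have "\<dots> < 1" using y \<delta> by (simp add: distrib_left)
  finally have zK: "K * norm (z - p) < 1" .
  have yK: "K * norm (y - p) < 1" using y by simp
  have "\<bar>\<rho> z - \<rho> y - g y \<bullet> (z - y)\<bar> \<le> K * (norm (z - y))\<^sup>2"
    by (rule taylor[OF yK zK])
  moreover have "K * (norm (z - y))\<^sup>2 \<le> 3 / 10 * \<delta>"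
    using mult_right_mono[OF \<delta>(2), of \<delta>] \<delta>(1) zy by (simp add: power2_eq_square mult_ac)
  moreover have "g y \<bullet> (z - y) \<ge> 3 * \<delta> * (3 / 4)"
  proof -
    have "\<bar>(g y - g p) \<bullet> g p\<bar> \<le> norm (g y - g p)"
      using Cauchy_Schwarz_ineq2[of "g y - g p" "g p"] normal by simp
    then have "g y \<bullet> g p \<ge> 3 / 4"
      using gradient_near_normal[OF yK] y normal by (simp add: inner_diff_left)
    then have "3 * \<delta> * (g y \<bullet> g p) \<ge> 3 * \<delta> * (3 / 4)" using \<delta> by (intro mult_left_mono) auto
    then show ?thesis by (simp add: z_def)
  qed
  ultimately have "\<rho> z > 0" using le \<delta> by argo
  then have "z \<notin> \<Omega>" using chart in_chart[OF zK] by (auto simp: boundary_chart_def)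
  then have "u z = 0" using outside interior_subset[of \<Omega>] S by blast
  then show ?thesis using lipschitz[of z y] zy by (simp add: mult_ac)
qed

section \<open>Rigid motions at a boundary point\<close>

context
  fixes t :: real and q :: "real^'n \<Rightarrow> real^'n"
  assumes t: "t > 0" "1000 * (K * t) \<le> 1"
    and q: "orthogonal_transformation q" "\<And>v. norm (q v - v - t *\<^sub>R A v) \<le> 2 * (K * t)\<^sup>2 * norm v"
begin

text \<open>With this constant the motion \<open>q x + c\<close> is the rotation \<open>q\<close>
  about \<open>p\<close> followed by the translation by \<open>t *\<^sub>R e\<close>.\<close>

abbreviation "c \<equiv> p + t *\<^sub>R e - q p"

lemma Kt2: "K * t\<^sup>2 \<le> t / 1000"
  using mult_right_mono[OF t(2), of t] t(1) by (simp add: power2_eq_square mult_ac)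

lemma displacement:
  assumes x: "norm (x - p) \<le> r"
  shows "norm (q x + c - x - t *\<^sub>R (e + A (x - p))) \<le> K * t\<^sup>2"
    and "norm (q x + c - x) \<le> 3 * t"
proof -
  have "q x - q p = q (x - p)" using q(1) by (simp add: linear_diff orthogonal_transformation_linear)
  then have eq: "q x + c - x - t *\<^sub>R (e + A (x - p)) = q (x - p) - (x - p) - t *\<^sub>R A (x - p)"
    by (simp add: algebra_simps)
  have "2 * (K * t)\<^sup>2 * norm (x - p) = 2 * (K * norm (x - p)) * (K * t\<^sup>2)"
    by (simp add: power2_eq_square mult_ac)
  also have "\<dots> \<le> 1 * (K * t\<^sup>2)"
    using near[OF x] K by (intro mult_right_mono) auto
  finally have "2 * (K * t)\<^sup>2 * norm (x - p) \<le> K * t\<^sup>2" by simp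
  then show 1: "norm (q x + c - x - t *\<^sub>R (e + A (x - p))) \<le> K * t\<^sup>2"
    unfolding eq using q(2)[of "x - p"] by linarith
  have "norm (t *\<^sub>R (e + A (x - p))) \<le> t * 2"
    using norm_tangent_le[OF x] t by (simp add: mult_left_mono)
  then show "norm (q x + c - x) \<le> 3 * t"
    using 1 Kt2 t norm_triangle_ineq[of "q x + c - x - t *\<^sub>R (e + A (x - p))" "t *\<^sub>R (e + A (x - p))"]
    by (simp only: diff_add_cancel)
qed

lemma moved_near:
  assumes x: "norm (x - p) \<le> r"
  shows "K * norm (q x + c - p) \<le> 1 / 8"
proof -
  have "norm (q x + c - p) \<le> norm (x - p) + 3 * t"
    using norm_triangle_ineq[of "q x + c - x" "x - p"] displacement(2)[OF x] by simp
  then have "K * norm (q x + c - p) \<le> K * (norm (x - p) + 3 * t)" using K by (intro mult_left_mono) auto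
  then show ?thesis using near[OF x] t by (simp add: distrib_left)
qed

text \<open>The crude bound serves to show that the points of interest satisfy
  \<open>\<bar>\<rho> x\<bar> \<le> 15 * t\<close>. In this thin layer the normal component of
  \<open>x - p\<close> is quadratic up to O(t), so that \<open>tangency\<close> yields the
  second-order bound.\<close>

lemma defining_function_change:
  assumes x: "norm (x - p) \<le> r"
  shows "\<bar>\<rho> (q x + c) - \<rho> x\<bar> \<le> 15 * t"
    and "\<bar>\<rho> x\<bar> \<le> 15 * t \<Longrightarrow>
      \<bar>\<rho> (q x + c) - \<rho> x\<bar> \<le> 5 * K\<^sup>2 * t * (norm (x - p))\<^sup>2 + 26 * K * t\<^sup>2"
proof -
  define y where "y = q x + c"
  define X where "X = x - p"
  have xK: "K * norm (x - p) < 1" using near[OF x] by linarith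
  have yK: "K * norm (y - p) < 1" using moved_near[OF x] by (simp add: y_def)
  have yx: "norm (y - x) \<le> 3 * t" using displacement(2)[OF x] by (simp add: y_def)
  then have "(norm (y - x))\<^sup>2 \<le> (3 * t)\<^sup>2" by (intro power_mono) auto
  then have "K * (norm (y - x))\<^sup>2 \<le> K * (3 * t)\<^sup>2" using K by (intro mult_left_mono) auto
  then have sq: "K * (norm (y - x))\<^sup>2 \<le> 9 * (K * t\<^sup>2)" by (simp add: power2_eq_square)
  have gx: "norm (g x) \<le> 2"
    using gradient_near_normal[OF xK] near[OF x] normal norm_triangle_ineq2[of "g x" "g p"] by simp
  have "norm (g x) * norm (y - x) \<le> 2 * (3 * t)" using gx yx by (intro mult_mono) auto
  then have "\<bar>g x \<bullet> (y - x)\<bar> \<le> 6 * t" using order_trans[OF Cauchy_Schwarz_ineq2[of "g x" "y - x"]] by simp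
  then show "\<bar>\<rho> (q x + c) - \<rho> x\<bar> \<le> 15 * t"
    using taylor[OF xK yK] sq Kt2 t unfolding y_def[symmetric] by linarith
  assume "\<bar>\<rho> x\<bar> \<le> 15 * t"
  then have "\<bar>g p \<bullet> X\<bar> \<le> 15 * t + K * (norm X)\<^sup>2"
    using normal_component[OF xK] by (simp add: X_def)
  then have "K * \<bar>g p \<bullet> X\<bar> \<le> K * (15 * t + K * (norm X)\<^sup>2)" using K by (intro mult_left_mono) auto
  then have "\<bar>g x \<bullet> (e + A X)\<bar> \<le> 15 * K * t + 5 * K\<^sup>2 * (norm X)\<^sup>2"
    using tangency[OF x] by (simp add: X_def power2_eq_square algebra_simps)
  then have "t * \<bar>g x \<bullet> (e + A X)\<bar> \<le> t * (15 * K * t + 5 * K\<^sup>2 * (norm X)\<^sup>2)"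
    using t by (intro mult_left_mono) auto
  then have "\<bar>g x \<bullet> (t *\<^sub>R (e + A X))\<bar> \<le> 15 * (K * t\<^sup>2) + 5 * K\<^sup>2 * t * (norm X)\<^sup>2"
  proof -
    have "\<bar>g x \<bullet> (t *\<^sub>R (e + A X))\<bar> = t * \<bar>g x \<bullet> (e + A X)\<bar>" using t by (simp only: inner_scaleR_right abs_mult)
    also have "\<dots> \<le> t * (15 * K * t + 5 * K\<^sup>2 * (norm X)\<^sup>2)" by fact
    also have "\<dots> = 15 * (K * t\<^sup>2) + 5 * K\<^sup>2 * t * (norm X)\<^sup>2" by (simp add: power2_eq_square algebra_simps)
    finally show ?thesis .
  qed
  moreover have "norm (g x) * norm (y - x - t *\<^sub>R (e + A X)) \<le> 2 * (K * t\<^sup>2)"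
    using gx displacement(1)[OF x] by (intro mult_mono) (auto simp: y_def X_def)
  then have "\<bar>g x \<bullet> (y - x - t *\<^sub>R (e + A X))\<bar> \<le> 2 * (K * t\<^sup>2)"
    using order_trans[OF Cauchy_Schwarz_ineq2] by blast
  moreover have "g x \<bullet> (y - x) = g x \<bullet> (y - x - t *\<^sub>R (e + A X)) + g x \<bullet> (t *\<^sub>R (e + A X))"
    by (simp add: inner_diff_right)
  \<comment> \<open>26 = 15 + 2 + 9: thickness of the layer, deviation of the motion from its
    velocity, and Taylor remainder of \<open>\<rho>\<close>.\<close>
  ultimately have "\<bar>\<rho> y - \<rho> x\<bar> \<le> 5 * K\<^sup>2 * t * (norm X)\<^sup>2 + 26 * (K * t\<^sup>2)"
    using taylor[OF xK yK] sq by linarith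
  then show "\<bar>\<rho> (q x + c) - \<rho> x\<bar> \<le> 5 * K\<^sup>2 * t * (norm (x - p))\<^sup>2 + 26 * K * t\<^sup>2"
    by (simp add: X_def y_def)
qed

text \<open>The points with \<open>bad\<close> are those where the difference need not be a
  solution. There one of the two values of \<open>u\<close> is zero, and the other point lies in a
  collar whose depth \<delta> is the second-order change of \<open>\<rho>\<close>; hence the factors
  15 = 3 * 5 and 78 = 3 * 26.\<close>

lemma boundary_values:
  assumes x: "x \<in> \<Omega>" "norm (x - p) \<le> r" and bad: "x \<notin> S \<or> q x + c \<notin> S"
  shows "\<bar>u (q x + c) - u x\<bar> \<le> 15 * M * K\<^sup>2 * t * (norm (x - p))\<^sup>2 + 78 * M * K * t\<^sup>2"
proof -
  define y where "y = q x + c"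
  define \<delta> where "\<delta> = 5 * K\<^sup>2 * t * (norm (x - p))\<^sup>2 + 26 * K * t\<^sup>2"
  have xK: "K * norm (x - p) < 1" using near[OF x(2)] by linarith
  have yK: "K * norm (y - p) \<le> 1 / 8" using moved_near[OF x(2)] by (simp add: y_def)
  have x0: "\<rho> x \<le> 0" using x(1) chart in_chart[OF xK] by (auto simp: boundary_chart_def)
  have \<delta>0: "\<delta> > 0" unfolding \<delta>_def using t K by (intro add_nonneg_pos) auto
  have \<delta>K: "K * \<delta> \<le> 1 / 30"
  proof -
    have "K * \<delta> = 5 * (K * norm (x - p)) * (K * norm (x - p)) * (K * t) + 26 * ((K * t) * (K * t))"
      by (simp add: \<delta>_def power2_eq_square algebra_simps)
    also have "\<dots> \<le> 5 * (1 / 16) * (1 / 16) * (1 / 1000) + 26 * ((1 / 1000) * (1 / 1000))"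
      using near[OF x(2)] t K by (intro add_mono mult_mono) auto
    finally show ?thesis by simp
  qed
  have "\<bar>u y - u x\<bar> \<le> 3 * \<delta> * M"
  proof (cases "x \<in> S")
    case False
    then have "\<rho> x = 0" using outside_nonneg[OF xK] x0 by simp
    then have "\<rho> y \<ge> - \<delta>"
      using defining_function_change(2)[OF x(2)] t by (simp add: y_def \<delta>_def)
    from collar[OF yK \<delta>0 \<delta>K this] show ?thesis using outside[OF False] by simp
  next
    case True
    then have y: "y \<notin> S" using bad by (simp add: y_def)
    have y0: "\<rho> y \<ge> 0" using outside_nonneg[OF _ y] yK by simp
    \<comment> \<open>\<open>\<rho>\<close> is at most 0 at \<open>x\<close> and at least 0 at its
      image, so its value at \<open>x\<close> is no larger than its change. This is what admits
      \<open>x\<close> to the thin layer.\<close>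
    then have "\<bar>\<rho> x\<bar> \<le> 15 * t"
      using defining_function_change(1)[OF x(2)] x0 unfolding y_def[symmetric] by linarith
    then have "\<rho> x \<ge> - \<delta>"
      using defining_function_change(2)[OF x(2)] y0 unfolding y_def[symmetric] \<delta>_def by linarith
    from collar[OF _ \<delta>0 \<delta>K this] show ?thesis using outside[OF y] near[OF x(2)] by simp
  qed
  then show ?thesis by (simp add: y_def \<delta>_def algebra_simps)
qed

text \<open>
  Quadratic barrier: on \<open>\<Omega>\<close> the linear term is essentially nonnegative because the boundary bends
  away from its tangent plane at \<open>p\<close> by at most \<open>K * (norm (x - p))\<^sup>2\<close>.
\<close>

lemma boundary_difference_le:
  assumes x: "x \<in> \<Omega>" "norm (x - p) \<le> r"
  shows "\<bar>u (q x + c) - u x\<bar> \<le> 18 * CARD('n) * M * t * norm (x - p) / r + 78 * M * K * t\<^sup>2"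
proof -
  define n where "n = real CARD('n)"
  have n: "n \<ge> 1" by (simp add: n_def Suc_leI)
  \<comment> \<open>Half of \<open>a * r^2\<close> is \<open>3 * M * t\<close>, the Lipschitz bound
    for the difference, which has to be dominated on the sphere of radius \<open>r\<close>.\<close>
  define a where "a = 6 * M * t / r\<^sup>2"
  have a: "a > 0" using M t r by (simp add: a_def)
  have ar: "a * r\<^sup>2 = 6 * M * t" using r by (simp add: a_def)
  \<comment> \<open>With s the coordinate along the outer normal and N the distance to
    \<open>p\<close>, the nonconstant part is a (N^2 - (n + 1) s (r + s)). Its Laplacian is - 2 a.
    Where s is negative the product s (r + s) is at most 0; where s is positive, s is at most K N^2,
    and the smallness of n K r leaves half of a N^2. The constant absorbs the t^2 term of
    \<open>boundary_values\<close>.\<close>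
  define W where "W = (\<lambda>z. a * ((z - p) \<bullet> (z - p)) + (- (n + 1) * r * a) * (g p \<bullet> (z - p))
      + (- (n + 1) * a) * (g p \<bullet> (z - p))\<^sup>2 + 78 * M * K * t\<^sup>2)"
  define R where "R = cball p r \<inter> \<Omega>"
  define U where "U = ball p r \<inter> S \<inter> {z. q z + c \<in> S}"
  have in_R: "z \<in> \<Omega> \<and> norm (z - p) \<le> r" if "z \<in> R" for z
    using that by (auto simp: R_def dist_norm norm_minus_commute)
  have normal_le: "\<bar>g p \<bullet> (z - p)\<bar> \<le> norm (z - p)" for z
    using Cauchy_Schwarz_ineq2[of "g p" "z - p"] normal by simp
  have W_lower: "W z \<ge> a / 2 * (norm (z - p))\<^sup>2 + 78 * M * K * t\<^sup>2" if z: "z \<in> \<Omega>" "norm (z - p) \<le> r" for z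
  proof -
    define s N where "s = g p \<bullet> (z - p)" and "N = norm (z - p)"
    have zK: "K * norm (z - p) < 1" using near[OF z(2)] by linarith
    then have "\<rho> z \<le> 0" using z(1) chart in_chart by (auto simp: boundary_chart_def)
    then have sK: "s \<le> K * N\<^sup>2" using normal_component[OF zK] by (simp add: s_def N_def)
    have sr: "\<bar>s\<bar> \<le> r" using normal_le[of z] z by (simp add: s_def)
    have N: "N \<ge> 0" by (simp add: N_def)
    have "(n + 1) * (s * (r + s)) \<le> N\<^sup>2 / 2"
    proof (cases "s \<ge> 0")
      case True
      have "(n + 1) * (s * (r + s)) \<le> (2 * n) * ((K * N\<^sup>2) * (2 * r))"
        using n sK sr r K True by (intro mult_mono) auto
      also have "\<dots> = 4 * (n * K * r) * N\<^sup>2" by simp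
      also have "\<dots> \<le> 4 * (1 / 16) * N\<^sup>2"
        using r(2) by (intro mult_right_mono) (auto simp: n_def)
      finally show ?thesis using zero_le_power2[of N] by linarith
    next
      case False
      then have "s * (r + s) \<le> 0" using sr by (intro mult_nonpos_nonneg) auto
      then have "(n + 1) * (s * (r + s)) \<le> 0" using n mult_nonneg_nonpos[of "n + 1" "s * (r + s)"] by linarith
      then show ?thesis using zero_le_power2[of N] by linarith
    qed
    then have "a * (N\<^sup>2 - (n + 1) * (s * (r + s))) \<ge> a * (N\<^sup>2 / 2)"
      using a by (intro mult_left_mono) auto
    then show ?thesis
      unfolding W_def s_def[symmetric] power2_norm_eq_inner[symmetric] N_def[symmetric]
      by (simp add: algebra_simps power2_eq_square)
  qed
  have W_upper: "W x \<le> 18 * n * M * t * norm (x - p) / r + 78 * M * K * t\<^sup>2"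
  proof -
    define s N where "s = g p \<bullet> (x - p)" and "N = norm (x - p)"
    have N: "0 \<le> N" "N \<le> r" "\<bar>s\<bar> \<le> N" using x normal_le[of x] by (auto simp: N_def s_def)
    have "N * N \<le> N * r" using N by (intro mult_left_mono) auto
    moreover have "(n + 1) * (r * - s + - s\<^sup>2) \<le> (n + 1) * (r * N)"
      using N n r by (intro mult_left_mono add_decreasing2) (auto intro: mult_left_mono)
    moreover have "1 * (r * N) \<le> n * (r * N)" using N n r by (intro mult_right_mono) auto
    ultimately have "N\<^sup>2 + (n + 1) * (r * - s + - s\<^sup>2) \<le> 3 * (n * (r * N))"
      by (simp add: power2_eq_square algebra_simps)
    then have "a * (N\<^sup>2 + (n + 1) * (r * - s + - s\<^sup>2)) \<le> a * (3 * (n * (r * N)))"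
      using a by (intro mult_left_mono) auto
    also have "\<dots> = 18 * n * M * t * N / r" using r by (simp add: a_def power2_eq_square)
    finally have "a * (N\<^sup>2 + (n + 1) * (r * - s + - s\<^sup>2)) \<le> 18 * n * M * t * N / r" .
    moreover have "W x = a * (N\<^sup>2 + (n + 1) * (r * - s + - s\<^sup>2)) + 78 * M * K * t\<^sup>2"
      unfolding W_def s_def[symmetric] power2_norm_eq_inner[symmetric] N_def[symmetric]
      by (simp add: algebra_simps)
    ultimately show ?thesis by (simp add: N_def)
  qed
  have openS: "open S" using S by simp
  have openq: "open {z. q z + c \<in> S}" using grad_hess_on_isometry[OF gh q(1), of c] by (simp add: grad_hess_on_def)
  have U: "open U" unfolding U_def by (intro open_Int openS openq) auto
  have UR: "U \<subseteq> R" using S interior_subset by (auto simp: U_def R_def)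
  have "W x + \<sigma> * (u (q x + c) - u x) \<ge> 0" if \<sigma>: "\<bar>\<sigma>\<bar> = 1" for \<sigma>
  proof (rule weak_minimum_principle[of R])
    show "compact R" unfolding R_def using \<Omega> by (simp add: compact_Int)
    show "x \<in> R" using x by (simp add: R_def dist_norm norm_minus_commute)
    have cu: "continuous_on UNIV u"
    proof (rule lipschitz_on_continuous_on)
      show "M-lipschitz_on UNIV u"
        using lipschitz M by (intro lipschitz_onI) (auto simp: dist_norm)
    qed
    have "continuous_on R (\<lambda>z. u (q z + c))"
      by (rule continuous_on_compose2[OF cu])
        (intro continuous_intros linear_continuous_on linear_linear[THEN iffD2]
          orthogonal_transformation_linear q(1), simp)
    then show "continuous_on R (\<lambda>x. W x + \<sigma> * (u (q x + c) - u x))"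
      unfolding W_def by (intro continuous_intros continuous_on_subset[OF cu]) auto
    fix z assume z: "z \<in> R"
    have \<sigma>_abs: "\<bar>\<sigma> * (u (q z + c) - u z)\<bar> = \<bar>u (q z + c) - u z\<bar>" using \<sigma> by (simp add: abs_mult)
    have K78: "78 * M * K * t\<^sup>2 \<ge> 0" using M K by simp
    have diff3: "\<bar>u (q z + c) - u z\<bar> \<le> 3 * M * t"
    proof -
      have "M * norm (q z + c - z) \<le> M * (3 * t)"
        using displacement(2)[of z] in_R[OF z] M by (intro mult_left_mono) auto
      then show ?thesis using lipschitz[of "q z + c" z] by linarith
    qed
    \<comment> \<open>In \<open>U\<close> the equation is available; on the sphere the Lipschitz
      bound decides; at the remaining points \<open>boundary_values\<close> does.\<close>
    consider "z \<in> U" | "norm (z - p) = r" | "z \<notin> S \<or> q z + c \<notin> S"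
      using in_R[OF z] by (fastforce simp: U_def dist_norm norm_minus_commute)
    then show "0 \<le> W z + \<sigma> * (u (q z + c) - u z) \<or> (\<exists>S G H. grad_hess_on S (\<lambda>x. W x + \<sigma> * (u (q x + c) - u x)) G H \<and>
      z \<in> S \<and> S \<subseteq> R \<and> trace (H z) < 0)"
    proof cases
      case 1
      have "grad_hess_on U u G H" by (rule grad_hess_on_subset[OF gh U]) (auto simp: U_def)
      moreover have "grad_hess_on U (\<lambda>x. u (q x + c)) (\<lambda>x. transpose (matrix q) *v G (q x + c))
         (\<lambda>x. transpose (matrix q) ** H (q x + c) ** matrix q)"
        by (rule grad_hess_on_subset[OF grad_hess_on_isometry[OF gh q(1)] U]) (auto simp: U_def)
      moreover note grad_hess_on_subset[OF grad_hess_on_quadratic U subset_UNIV, of a p "- (n + 1) * r * a" "g p" "- (n + 1) * a" "78 * M * K * t\<^sup>2",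
          folded W_def]
      ultimately have "grad_hess_on U (\<lambda>x. W x + \<sigma> * (u (q x + c) - u x))
          (\<lambda>x. ((2 * a) *\<^sub>R (x - p) + (- (n + 1) * r * a + 2 * (- (n + 1) * a) * (g p \<bullet> (x - p))) *\<^sub>R g p)
             + \<sigma> *\<^sub>R (transpose (matrix q) *v G (q x + c) - G x))
          (\<lambda>x. ((2 * a) *\<^sub>R mat 1 + (2 * (- (n + 1) * a)) *\<^sub>R outer_square (g p))
             + \<sigma> *\<^sub>R (transpose (matrix q) ** H (q x + c) ** matrix q - H x))"
        by (intro grad_hess_on_add grad_hess_on_cmult grad_hess_on_diff)
      moreover have "trace (((2 * a) *\<^sub>R mat 1 + (2 * (- (n + 1) * a)) *\<^sub>R outer_square (g p))
             + \<sigma> *\<^sub>R (transpose (matrix q) ** H (q z + c) ** matrix q - H z)) < 0"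
      proof -
        have "trace (H z) = - lam * u z" "trace (H (q z + c)) = - lam * u (q z + c)"
          using 1 eigen by (auto simp: U_def)
        then have "trace (((2 * a) *\<^sub>R mat 1 + (2 * (- (n + 1) * a)) *\<^sub>R outer_square (g p))
             + \<sigma> *\<^sub>R (transpose (matrix q) ** H (q z + c) ** matrix q - H z))
           = - 2 * a - lam * (\<sigma> * (u (q z + c) - u z))"
          unfolding trace_add[of _ "\<sigma> *\<^sub>R _"] trace_quadratic trace_scaleR trace_sub trace_orthogonal_conjugate[OF q(1)]
          by (simp add: normal n_def algebra_simps)
        moreover have "lam * \<bar>\<sigma> * (u (q z + c) - u z)\<bar> \<le> lam * (3 * M * t)"
          unfolding \<sigma>_abs using lam diff3 by (intro mult_left_mono) auto
        moreover have "lam * (3 * M * t) \<le> a"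
        proof -
          have "lam * r\<^sup>2 * (3 * M * t) \<le> 1 * (3 * M * t)" using r M t by (intro mult_right_mono) auto
          then have "lam * (3 * M * t) \<le> 3 * M * t / r\<^sup>2" using r by (simp add: field_simps)
          also have "\<dots> \<le> a" unfolding a_def using M t r by (intro divide_right_mono) auto
          finally show ?thesis .
        qed
        moreover have "- (lam * (\<sigma> * (u (q z + c) - u z))) \<le> lam * \<bar>\<sigma> * (u (q z + c) - u z)\<bar>"
          using lam mult_left_mono[of "- (\<sigma> * (u (q z + c) - u z))" "\<bar>\<sigma> * (u (q z + c) - u z)\<bar>" lam] by simp
        ultimately show ?thesis using a by linarith
      qed
      ultimately show ?thesis using 1 UR by blast
    next
      case 2
      have "a / 2 * (norm (z - p))\<^sup>2 = 3 * M * t" using ar 2 by simp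
      then have "W z \<ge> 3 * M * t" using W_lower[of z] in_R[OF z] K78 by linarith
      then show ?thesis using diff3 \<sigma>_abs by linarith
    next
      case 3
      have "15 * M * K\<^sup>2 * t * (norm (z - p))\<^sup>2 \<le> a / 2 * (norm (z - p))\<^sup>2"
      proof (rule mult_right_mono)
        have "(K * r)\<^sup>2 \<le> (1 / 16)\<^sup>2" using Kr K r by (intro power_mono) auto
        then have "15 * M * t * (K * r)\<^sup>2 \<le> 15 * M * t * (1 / 16)\<^sup>2" using M t by (intro mult_left_mono) auto
        also have "\<dots> \<le> 3 * M * t" using M t by (simp add: power2_eq_square)
        finally show "15 * M * K\<^sup>2 * t \<le> a / 2" using r by (simp add: a_def field_simps power2_eq_square)
      qed simp
      then show ?thesis
        using W_lower[of z] in_R[OF z] boundary_values[of z] 3 \<sigma>_abs by linarith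
    qed
  qed
  from this[of 1] this[of "-1"] have "\<bar>u (q x + c) - u x\<bar> \<le> W x" by simp
  then show ?thesis using W_upper by (simp add: n_def)
qed

end

end

subsection \<open>Second derivatives up to the boundary\<close>

lemma has_vector_derivative_of_quadratic_error:
  fixes \<gamma> :: "real \<Rightarrow> 'a::real_normed_vector"
  assumes \<delta>: "\<delta> > 0" and le: "\<And>t. \<bar>t\<bar> < \<delta> \<Longrightarrow> norm (\<gamma> t - \<gamma> 0 - t *\<^sub>R T) \<le> K * t\<^sup>2"
  shows "(\<gamma> has_vector_derivative T) (at 0)"
  unfolding has_vector_derivative_def has_derivative_at_alt
proof (intro conjI allI impI)
  show "bounded_linear (\<lambda>x. x *\<^sub>R T)" by (rule bounded_linear_scaleR_left)
  fix \<epsilon> :: real assume \<epsilon>: "\<epsilon> > 0"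
  define d where "d = min \<delta> (\<epsilon> / (\<bar>K\<bar> + 1))"
  have "norm (\<gamma> t - \<gamma> 0 - (t - 0) *\<^sub>R T) \<le> \<epsilon> * norm (t - 0)" if "norm (t - 0) < d" for t
  proof -
    have "\<bar>t\<bar> * (\<bar>K\<bar> + 1) \<le> \<epsilon>" using that by (simp add: d_def field_simps)
    then have "\<bar>t\<bar> * (\<bar>K\<bar> + 1) * \<bar>t\<bar> \<le> \<epsilon> * \<bar>t\<bar>" by (rule mult_right_mono) simp
    moreover have "K * t\<^sup>2 \<le> (\<bar>K\<bar> + 1) * t\<^sup>2" by (intro mult_right_mono) auto
    moreover have "\<bar>t\<bar> * (\<bar>K\<bar> + 1) * \<bar>t\<bar> = (\<bar>K\<bar> + 1) * t\<^sup>2"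
      by (simp add: power2_eq_square mult_ac)
    moreover have "norm (\<gamma> t - \<gamma> 0 - t *\<^sub>R T) \<le> K * t\<^sup>2" using that le by (simp add: d_def)
    ultimately show ?thesis by simp
  qed
  moreover have "d > 0" using \<delta> \<epsilon> by (simp add: d_def)
  ultimately show "\<exists>d>0. \<forall>t. norm (t - 0) < d \<longrightarrow> norm (\<gamma> t - \<gamma> 0 - (t - 0) *\<^sub>R T) \<le> \<epsilon> * norm (t - 0)"
    by blast
qed

context boundary_point
begin

text \<open>The ball of radius \<open>d / 2\<close> about \<open>x\<close> lies within
  \<open>3 * d / 2\<close> of \<open>p\<close>, so the barrier gives a difference of order t d / r,
  and the factor d cancels the 1 / d of the interior estimate. The summand with
  \<open>K / d * t\<close> is not uniform in \<open>d\<close>, but vanishes with \<open>t\<close>.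
  The last summand is the turn of \<open>G x\<close> by \<open>q\<close>.\<close>

lemma gradient_variation_le:
  assumes x: "ball x d \<subseteq> S" "norm (x - p) = d" "d > 0" "2 * d \<le> r"
    and t: "t > 0" "1000 * (K * t) \<le> 1" "6 * t < d"
    and q: "orthogonal_transformation q" "\<And>v. norm (q v - v - t *\<^sub>R A v) \<le> 2 * (K * t)\<^sup>2 * norm v"
  shows "norm (G (q x + (p + t *\<^sub>R e - q p)) - G x)
    \<le> t * (108 * (CARD('n))\<^sup>2 * M / r + 312 * CARD('n) * M * K / d * t + 3 * K * M)"
proof -
  let ?c = "p + t *\<^sub>R e - q p"
  define n where "n = real CARD('n)"
  define m where "m = 27 * n * M * t * d / r + 78 * M * K * t\<^sup>2"
  have n: "n > 0" by (simp add: n_def)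
  have m: "m > 0" unfolding m_def using n M t x r K by (intro add_pos_pos) auto
  have near_p: "norm (z - p) \<le> 3 * d / 2" if "z \<in> cball x (d / 2)" for z
    using norm_triangle_ineq[of "z - x" "x - p"] that x by (simp add: dist_norm norm_minus_commute)
  have small: "cball x (d / 2) \<subseteq> S" using x by (auto simp: subset_iff)
  have "d \<le> r" using x by simp
  then have "lam * (d / 2)\<^sup>2 \<le> lam * r\<^sup>2" using lam x by (intro mult_left_mono power_mono) auto
  then have lamd: "lam * (d / 2)\<^sup>2 \<le> 1" using r by linarith
  have "norm (G (q x + ?c) - G x) \<le> 2 * CARD('n) * m / (d / 2) + norm (q (G x) - G x)"
  proof (rule gradient_difference_le[OF q(1) _ lamd m small])
    show "d / 2 > 0" using x by simp
    fix z assume z: "z \<in> cball x (d / 2)"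
    have zr: "norm (z - p) \<le> r" using near_p[OF z] x by linarith
    have "norm (q z + ?c - z) \<le> 3 * t" by (rule displacement(2)[OF t(1,2) q zr])
    then have "dist z (q z + ?c) \<le> 3 * t" by (metis dist_norm dist_commute)
    moreover have "dist x z \<le> d / 2" using z by simp
    ultimately have "dist x (q z + ?c) < d"
      using t dist_triangle[of x "q z + ?c" z] by linarith
    then show "q z + ?c \<in> S" using x by (auto simp: subset_iff)
    have "z \<in> \<Omega>" using small z S interior_subset by blast
    from boundary_difference_le[OF t(1,2) q this zr]
    have "\<bar>u (q z + ?c) - u z\<bar> \<le> 18 * n * M * t * norm (z - p) / r + 78 * M * K * t\<^sup>2"
      by (simp add: n_def)
    also have "18 * n * M * t * norm (z - p) / r \<le> 18 * n * M * t * (3 * d / 2) / r"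
      using near_p[OF z] n M t r by (intro divide_right_mono mult_left_mono) auto
    finally show "\<bar>u (q z + ?c) - u z\<bar> \<le> m" by (simp add: m_def mult_ac)
  qed
  also have "2 * CARD('n) * m / (d / 2) = t * (108 * n\<^sup>2 * M / r + 312 * n * M * K / d * t)"
    using x r by (simp add: m_def n_def field_simps power2_eq_square)
  also have "norm (q (G x) - G x) \<le> t * (3 * K * M)"
  proof -
    have xS: "x \<in> S" using x by auto
    have "norm (q (G x) - G x) \<le> norm (q (G x) - G x - t *\<^sub>R A (G x)) + norm (t *\<^sub>R A (G x))"
      using norm_triangle_ineq[of "q (G x) - G x - t *\<^sub>R A (G x)" "t *\<^sub>R A (G x)"] by (simp only: diff_add_cancel)
    also have "\<dots> \<le> 2 * (K * t)\<^sup>2 * norm (G x) + t * (2 * K * norm (G x))"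
      using q(2)[of "G x"] norm_A_le[of "G x"] t by (intro add_mono) auto
    also have "\<dots> = (2 * (K * t) + 2) * (t * (K * norm (G x)))"
      by (simp add: power2_eq_square algebra_simps)
    also have "\<dots> \<le> 3 * (t * (K * M))"
      using t K grad_le[OF xS] by (intro mult_mono) auto
    finally show ?thesis by (simp add: mult_ac)
  qed
  finally show ?thesis by (simp add: n_def algebra_simps)
qed

text \<open>Differentiating along the motion gives the derivative of \<open>G\<close> in the
  direction e + A (x - p) instead of \<open>e\<close>. The correction is harmless although the
  interior Hessian bound blows up like 1 / d, because \<open>A (x - p)\<close> is at most
  \<open>2 * K * d\<close> in norm.\<close>

lemma tangential_hessian_le:
  assumes x: "ball x d \<subseteq> S" "norm (x - p) = d" "d > 0" "2 * d \<le> r"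
  shows "norm (H x *v e) \<le> 110 * (CARD('n))\<^sup>2 * M / r"
proof -
  define n where "n = real CARD('n)"
  have n: "n \<ge> 1" by (simp add: n_def Suc_leI)
  have xr: "norm (x - p) \<le> r" using x by simp
  define T where "T = e + A (x - p)"
  define t0 where "t0 = 1 / (1000 * K)"
  have t0: "t0 > 0" using K by (simp add: t0_def)
  have Kt: "1000 * (K * t) \<le> 1" if "t < t0" for t using that K by (simp add: t0_def field_simps)
  have "\<exists>q. orthogonal_transformation q \<and> (\<forall>v. norm (q v - v - t *\<^sub>R A v) \<le> 2 * (K * t)\<^sup>2 * norm v)"
    if "0 < t" "t < t0" for t
    unfolding A_def using rotation_exists[OF normal(1) b] that Kt[OF that(2)] by simp
  then obtain q where q: "\<And>t. 0 < t \<Longrightarrow> t < t0 \<Longrightarrow> orthogonal_transformation (q t)"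
    "\<And>t v. 0 < t \<Longrightarrow> t < t0 \<Longrightarrow> norm (q t v - v - t *\<^sub>R A v) \<le> 2 * (K * t)\<^sup>2 * norm v"
    by metis
  \<comment> \<open>The rotations are chosen separately for each \<open>t\<close>, with no
    continuity in \<open>t\<close>; the quadratic error alone gives the velocity at 0. The straight
    line for other \<open>t\<close> only makes the derivative two-sided.\<close>
  define \<gamma> where "\<gamma> t = (if 0 < t \<and> t < t0 then q t x + (p + t *\<^sub>R e - q t p) else x + t *\<^sub>R T)" for t
  have \<gamma>0: "\<gamma> 0 = x" by (simp add: \<gamma>_def)
  have "norm (H (\<gamma> 0) *v T) \<le> 108 * n\<^sup>2 * M / r + 3 * K * M"
  proof (rule norm_hessian_le)
    show "(\<gamma> has_vector_derivative T) (at 0)"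
    proof (rule has_vector_derivative_of_quadratic_error[OF t0])
      fix t assume t: "\<bar>t\<bar> < t0"
      show "norm (\<gamma> t - \<gamma> 0 - t *\<^sub>R T) \<le> K * t\<^sup>2"
      proof (cases "0 < t")
        case True
        then have tt: "0 < t" "t < t0" using t by auto
        show ?thesis
          using displacement(1)[OF tt(1) Kt[OF tt(2)] q(1)[OF tt] q(2)[OF tt] xr] tt
          unfolding \<gamma>0 T_def by (simp add: \<gamma>_def)
      next
        case False
        then show ?thesis using K unfolding \<gamma>0 by (simp add: \<gamma>_def)
      qed
    qed
    show "\<gamma> 0 \<in> S" using x \<gamma>0 by auto
    let ?c = "\<lambda>t. 108 * n\<^sup>2 * M / r + 312 * n * M * K / d * t + 3 * K * M"
    have "(?c \<longlongrightarrow> 108 * n\<^sup>2 * M / r + 312 * n * M * K / d * 0 + 3 * K * M) (at_right 0)"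
      by (intro tendsto_intros)
    then show "(?c \<longlongrightarrow> 108 * n\<^sup>2 * M / r + 3 * K * M) (at_right 0)" by simp
    have "\<forall>\<^sub>F t in at_right 0. t \<in> {0<..<min t0 (d / 6)}"
      by (rule eventually_at_right_real) (use t0 x in simp)
    then show "\<forall>\<^sub>F t in at_right 0. norm (G (\<gamma> t) - G (\<gamma> 0)) \<le> t * ?c t"
    proof eventually_elim
      case (elim t)
      then have tt: "0 < t" "t < t0" "6 * t < d" by auto
      show ?case
        using gradient_variation_le[OF x tt(1) Kt[OF tt(2)] tt(3) q(1)[OF tt(1,2)] q(2)[OF tt(1,2)]] tt
        unfolding \<gamma>0 by (simp add: \<gamma>_def n_def)
    qed
  qed
  then have HT: "norm (H x *v T) \<le> 108 * n\<^sup>2 * M / r + 3 * K * M" by (simp add: \<gamma>0)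
  have "lam * d\<^sup>2 \<le> lam * r\<^sup>2" using lam x by (intro mult_left_mono power_mono) auto
  then have lamd: "lam * d\<^sup>2 \<le> 1" using r by linarith
  have "norm (H x *v A (x - p)) \<le> 4 * n * M / d * norm (A (x - p))"
    unfolding n_def using interior_hessian_le[OF x(3) lamd x(1), of "A (x - p)"] by simp
  also have "\<dots> \<le> 4 * n * M / d * (2 * K * d)"
    using norm_A_le[of "x - p"] x n M by (intro mult_left_mono) auto
  also have "\<dots> = 8 * n * K * M" using x by simp
  finally have HA: "norm (H x *v A (x - p)) \<le> 8 * n * K * M" .
  have "H x *v e = H x *v T - H x *v A (x - p)" by (simp add: T_def matrix_vector_right_distrib)
  then have "norm (H x *v e) \<le> norm (H x *v T) + norm (H x *v A (x - p))"
    by (simp only: norm_triangle_ineq4)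
  then have "norm (H x *v e) \<le> 108 * n\<^sup>2 * M / r + 3 * K * M + 8 * n * K * M"
    using HT HA by linarith
  also have "\<dots> \<le> 110 * n\<^sup>2 * M / r"
  proof -
    \<comment> \<open>The curvature terms are absorbed into M / r by
      \<open>16 * n * K * r \<le> 1\<close>, raising 108 to 110.\<close>
    have "1 * (K * M) \<le> n * (K * M)" using n K M by (intro mult_right_mono) auto
    then have "3 * K * M + 8 * n * K * M \<le> 11 * (n * K * M)" by (simp add: mult_ac)
    also have "n * K \<le> 1 / 16 / r" using r by (simp add: n_def field_simps)
    then have "11 * (n * K * M) \<le> 11 * (1 / 16 / r * M)" using M by (intro mult_left_mono mult_right_mono) auto
    also have "\<dots> \<le> 2 * (1 * M / r)" using M r by (simp add: field_simps)
    also have "\<dots> \<le> 2 * (n\<^sup>2 * M / r)"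
      using n M r by (intro mult_left_mono divide_right_mono mult_right_mono) (auto simp: one_le_power)
    finally have "3 * K * M + 8 * n * K * M \<le> 2 * (n\<^sup>2 * M / r)" by simp
    moreover have "108 * n\<^sup>2 * M / r + 2 * (n\<^sup>2 * M / r) = 110 * n\<^sup>2 * M / r"
      using r by (simp add: field_simps)
    ultimately show ?thesis by argo
  qed
  finally show ?thesis by (simp add: n_def)
qed

end

section \<open>From tangential directions to the full Hessian\<close>

context lipschitz_eigenfunction
begin

text \<open>Splitting \<xi> into a multiple of \<mu> and a tangential part leaves three kinds of
  terms. The mixed ones reduce to the tangential bound by symmetry of the Hessian, and the purely
  normal one is recovered from the trace. Altogether (n + 1) + 2 + 1 \<le> 5 n.\<close>

lemma hessian_le_of_tangential:
  fixes E :: real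
  assumes x: "x \<in> S" and \<mu>: "norm \<mu> = 1" and E: "E \<ge> 0"
    and tang: "\<And>e. norm e \<le> 1 \<Longrightarrow> \<mu> \<bullet> e = 0 \<Longrightarrow> norm (H x *v e) \<le> E"
    and tr: "\<bar>trace (H x)\<bar> \<le> E" and \<xi>: "norm \<xi> = 1"
  shows "\<bar>(H x *v \<xi>) \<bullet> \<xi>\<bar> \<le> 5 * CARD('n) * E"
proof -
  define n where "n = real CARD('n)"
  have n: "n \<ge> 1" by (simp add: n_def Suc_leI)
  have \<mu>\<mu>: "\<mu> \<bullet> \<mu> = 1" using \<mu> by (simp add: norm_eq_1)
  have proj: "norm (v - (\<mu> \<bullet> v) *\<^sub>R \<mu>) \<le> 1 \<and> \<mu> \<bullet> (v - (\<mu> \<bullet> v) *\<^sub>R \<mu>) = 0" if v: "norm v = 1" for v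
  proof
    have "(v - (\<mu> \<bullet> v) *\<^sub>R \<mu>) \<bullet> (v - (\<mu> \<bullet> v) *\<^sub>R \<mu>) = v \<bullet> v - (\<mu> \<bullet> v)\<^sup>2"
      by (simp add: inner_diff_left inner_diff_right \<mu>\<mu> power2_eq_square inner_commute)
    then have "(norm (v - (\<mu> \<bullet> v) *\<^sub>R \<mu>))\<^sup>2 \<le> 1\<^sup>2" using v by (simp add: power2_norm_eq_inner norm_eq_1)
    then show "norm (v - (\<mu> \<bullet> v) *\<^sub>R \<mu>) \<le> 1" by (rule power2_le_imp_le) simp
    show "\<mu> \<bullet> (v - (\<mu> \<bullet> v) *\<^sub>R \<mu>) = 0" by (simp add: inner_diff_right \<mu>\<mu>)
  qed
  have nn: "\<bar>(H x *v \<mu>) \<bullet> \<mu>\<bar> \<le> (n + 1) * E"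
  proof -
    let ?\<tau> = "\<lambda>i. axis i 1 - (\<mu> \<bullet> axis i 1) *\<^sub>R \<mu>"
    have \<tau>: "\<bar>(H x *v ?\<tau> i) $ i\<bar> \<le> E" for i
      using tang[of "?\<tau> i"] proj[of "axis i 1"] component_le_norm_cart[of "H x *v ?\<tau> i" i] by (simp add: norm_axis_1)
    have "(H x *v ?\<tau> i) $ i = H x $ i $ i - \<mu> $ i * (H x *v \<mu>) $ i" for i
      by (simp add: matrix_vector_mult_diff_distrib matrix_vector_mult_scaleR matrix_vector_mult_basis column_def inner_axis)
    \<comment> \<open>Projecting every coordinate axis to the tangent plane expresses the tangential
      trace without choosing an orthonormal basis adapted to \<mu>.\<close>
    then have "(\<Sum>i\<in>UNIV. (H x *v ?\<tau> i) $ i) = trace (H x) - (H x *v \<mu>) \<bullet> \<mu>"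
      by (simp add: trace_def sum_subtractf inner_vec_def mult.commute)
    moreover have "\<bar>\<Sum>i\<in>UNIV. (H x *v ?\<tau> i) $ i\<bar> \<le> n * E"
    proof -
      have "\<bar>\<Sum>i\<in>UNIV. (H x *v ?\<tau> i) $ i\<bar> \<le> (\<Sum>i\<in>(UNIV::'n set). E)"
        by (rule order_trans[OF sum_abs sum_mono[OF \<tau>]])
      then show ?thesis by (simp add: n_def)
    qed
    ultimately show ?thesis using tr by (simp add: distrib_right)
  qed
  define a \<tau> where "a = \<mu> \<bullet> \<xi>" and "\<tau> = \<xi> - (\<mu> \<bullet> \<xi>) *\<^sub>R \<mu>"
  have \<tau>: "norm \<tau> \<le> 1" "\<mu> \<bullet> \<tau> = 0" using proj[OF \<xi>] by (auto simp: \<tau>_def)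
  have a: "\<bar>a\<bar> \<le> 1" using Cauchy_Schwarz_ineq2[of \<mu> \<xi>] \<mu> \<xi> by (simp add: a_def)
  have \<xi>_eq: "\<xi> = a *\<^sub>R \<mu> + \<tau>" by (simp add: a_def \<tau>_def)
  have H\<tau>: "norm (H x *v \<tau>) \<le> E" using tang \<tau> by blast
  have sym: "(H x *v \<mu>) \<bullet> \<tau> = (H x *v \<tau>) \<bullet> \<mu>" by (rule hessian_symmetric[OF gh x])
  have "(H x *v \<xi>) \<bullet> \<xi> = a * a * ((H x *v \<mu>) \<bullet> \<mu>) + 2 * (a * ((H x *v \<tau>) \<bullet> \<mu>)) + (H x *v \<tau>) \<bullet> \<tau>"
    unfolding \<xi>_eq by (simp add: matrix_vector_right_distrib matrix_vector_mult_scaleR inner_add_left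
        inner_add_right sym algebra_simps)
  moreover have "\<bar>a * a * ((H x *v \<mu>) \<bullet> \<mu>)\<bar> \<le> 1 * 1 * ((n + 1) * E)"
    unfolding abs_mult using a nn n E by (intro mult_mono) auto
  moreover have "\<bar>(H x *v \<tau>) \<bullet> \<mu>\<bar> \<le> E"
    using Cauchy_Schwarz_ineq2[of "H x *v \<tau>" \<mu>] H\<tau> \<mu> by simp
  then have "\<bar>a * ((H x *v \<tau>) \<bullet> \<mu>)\<bar> \<le> 1 * E"
    unfolding abs_mult using a E by (intro mult_mono) auto
  moreover have "\<bar>(H x *v \<tau>) \<bullet> \<tau>\<bar> \<le> E * 1"
    using Cauchy_Schwarz_ineq2[of "H x *v \<tau>" \<tau>] mult_mono[OF H\<tau> \<tau>(1) E norm_ge_zero] by linarith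
  ultimately have "\<bar>(H x *v \<xi>) \<bullet> \<xi>\<bar> \<le> (n + 1) * E + 3 * E" by linarith
  also have "\<dots> = n * E + 4 * (1 * E)" by (simp add: algebra_simps)
  also have "\<dots> \<le> n * E + 4 * (n * E)" using n E by (intro add_left_mono mult_left_mono mult_right_mono) auto
  finally show ?thesis by (simp add: n_def mult_ac)
qed

lemma second_derivative_le:
  fixes K r :: real
  assumes S: "S = interior \<Omega>" and \<Omega>: "compact \<Omega>"
    and charts: "\<And>p. p \<in> frontier \<Omega> \<Longrightarrow> \<exists>\<rho> g B. boundary_chart \<Omega> K p \<rho> g B"
    and K: "K \<ge> 1" and r: "r > 0" "16 * CARD('n) * K * r \<le> 1" "lam * r\<^sup>2 \<le> 1"
    and x: "x \<in> S" and \<xi>: "norm \<xi> = 1"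
  shows "\<bar>(H x *v \<xi>) \<bullet> \<xi>\<bar> \<le> 550 * CARD('n) ^ 3 * M / r"
proof -
  define n where "n = real CARD('n)"
  have n: "n \<ge> 1" by (simp add: n_def Suc_leI)
  have "bounded S" using S \<Omega> bounded_subset[OF compact_imp_bounded interior_subset] by blast
  then have "- S \<noteq> {}" using not_bounded_UNIV by (metis Compl_empty_eq double_compl)
  moreover have "closed (- S)" using S by (simp add: closed_Compl)
  ultimately obtain p where p: "p \<in> - S" "\<And>y. y \<in> - S \<Longrightarrow> dist x p \<le> dist x y"
    using distance_attains_inf[of "- S" x] by blast
  define d where "d = dist x p"
  have ball: "ball x d \<subseteq> S" using p(2) by (force simp: d_def)
  have d: "d > 0" using p x by (auto simp: d_def)
  show ?thesis
  proof (cases "2 * d \<le> r")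
    case True
    have "p \<in> closure (ball x d)" using d by (simp add: d_def)
    also have "\<dots> \<subseteq> closure \<Omega>" using ball S interior_subset by (intro closure_mono) blast
    finally have "p \<in> frontier \<Omega>" using p S by (simp add: frontier_def)
    from charts[OF this] obtain \<rho> g B where chart: "boundary_chart \<Omega> K p \<rho> g B" by blast
    have "\<bar>(H x *v \<xi>) \<bullet> \<xi>\<bar> \<le> 5 * CARD('n) * (110 * n\<^sup>2 * M / r)"
    proof (rule hessian_le_of_tangential[OF x, of "g p"])
      show "norm (g p) = 1" using chart by (simp add: boundary_chart_def)
      show "110 * n\<^sup>2 * M / r \<ge> 0" using M r by simp
      show "norm (H x *v e) \<le> 110 * n\<^sup>2 * M / r" if "norm e \<le> 1" "g p \<bullet> e = 0" for e
      proof -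
        interpret boundary_point S u G H M lam \<Omega> p K \<rho> g B r e
          by unfold_locales (use chart S \<Omega> K r that in auto)
        show ?thesis
          using tangential_hessian_le[OF ball _ d True] by (simp add: d_def dist_norm n_def)
      qed
      \<comment> \<open>Since \<open>u\<close> vanishes at \<open>p\<close>, the equation bounds the
        trace by lam M d, hence by M / r.\<close>
      have "\<bar>u x\<bar> \<le> M * d" using lipschitz[of x p] outside[of p] p by (simp add: d_def dist_norm)
      also have "\<dots> \<le> M * r" using True d M by (intro mult_left_mono) auto
      finally have "lam * \<bar>u x\<bar> \<le> lam * (M * r)" using lam by (intro mult_left_mono) auto
      also have "\<dots> = lam * r\<^sup>2 * (M / r)" using r by (simp add: power2_eq_square)
      also have "\<dots> \<le> 1 * (M / r)" using r M by (intro mult_right_mono) auto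
      also have "\<dots> \<le> 110 * n\<^sup>2 * (M / r)"
      proof (rule mult_right_mono)
        have "1 \<le> n\<^sup>2" using n by (rule one_le_power)
        then show "1 \<le> 110 * n\<^sup>2" by simp
      qed (use M r in simp)
      finally show "\<bar>trace (H x)\<bar> \<le> 110 * n\<^sup>2 * M / r"
        using eigen[OF x] lam by (simp add: abs_mult)
    qed (rule \<xi>)
    then show ?thesis by (simp add: n_def power2_eq_square power3_eq_cube)
  next
    case False
    have "(r / 2)\<^sup>2 \<le> r\<^sup>2" using r by (intro power_mono) auto
    then have "lam * (r / 2)\<^sup>2 \<le> lam * r\<^sup>2" using lam by (intro mult_left_mono) auto
    then have "lam * (r / 2)\<^sup>2 \<le> 1" using r by linarith
    moreover have "ball x (r / 2) \<subseteq> S" using False ball by (auto simp: subset_iff)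
    ultimately have "norm (H x *v \<xi>) \<le> 4 * CARD('n) * M / (r / 2) * norm \<xi>"
      using r by (intro interior_hessian_le) auto
    then have "\<bar>(H x *v \<xi>) \<bullet> \<xi>\<bar> \<le> 8 * (n * M / r)"
      using Cauchy_Schwarz_ineq2[of "H x *v \<xi>" \<xi>] \<xi> by (simp add: n_def)
    also have "\<dots> \<le> 550 * (n ^ 3 * M / r)"
    proof (intro mult_mono divide_right_mono mult_right_mono)
      show "n \<le> n ^ 3" using power_increasing[of 1 3 n] n by simp
    qed (use n M r in auto)
    finally show ?thesis by (simp add: n_def)
  qed
qed

end

subsection \<open>Uniform boundary charts\<close>

lemma has_derivative_gradient:
  fixes f :: "real^'n \<Rightarrow> real"
  assumes "f differentiable (at x)"
  shows "(f has_derivative (\<lambda>h. gradient f x \<bullet> h)) (at x)"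
proof -
  have fd: "(f has_derivative frechet_derivative f (at x)) (at x)"
    using assms frechet_derivative_works by blast
  then have lin: "linear (frechet_derivative f (at x))" by (rule has_derivative_linear)
  have "frechet_derivative f (at x) h = gradient f x \<bullet> h" for h
  proof -
    have "frechet_derivative f (at x) h = frechet_derivative f (at x) (\<Sum>i\<in>UNIV. (h $ i) *\<^sub>R axis i 1)"
      using basis_expansion[of h] by (simp add: scalar_mult_eq_scaleR)
    also have "\<dots> = gradient f x \<bullet> h"
      by (simp add: linear_sum[OF lin] linear_scale[OF lin] inner_vec_def gradient_def dir_deriv_def mult.commute)
    finally show ?thesis .
  qed
  then show ?thesis using fd by (metis (no_types, lifting) ext)
qed

text \<open>Row \<open>i\<close> is the gradient of the \<open>i\<close>-th partial derivative, so
  that multiplication by this matrix is directly the derivative of the gradient.\<close>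

definition hessian :: "(real^'n \<Rightarrow> real) \<Rightarrow> real^'n \<Rightarrow> real^'n^'n"
  where "hessian f x = (\<chi> i j. partial_deriv j (partial_deriv i f) x)"

lemma trace_hessian: "trace (hessian f x) = laplacian f x"
  by (simp add: trace_def hessian_def laplacian_def)

lemma dir_deriv_has_derivative:
  "(f has_derivative f') (at x) \<Longrightarrow> dir_deriv v f x = f' v"
  by (metis dir_deriv_def frechet_derivative_at)

lemma grad_hess_on_Ck:
  fixes f :: "real^'n \<Rightarrow> real"
  assumes S: "open S" and f: "Ck_on 2 S f"
  shows "grad_hess_on S f (gradient f) (hessian f)"
  unfolding grad_hess_on_def
proof (intro conjI ballI S)
  fix x assume x: "x \<in> S"
  have f2: "f differentiable_on S" "\<And>i. partial_deriv i f differentiable_on S"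
    using f by (auto simp: numeral_2_eq_2)
  have d: "h differentiable (at x)" if "h differentiable_on S" for h :: "real^'n \<Rightarrow> real"
    using that x S by (simp add: differentiable_on_eq_differentiable_at)
  show "(f has_derivative (\<lambda>h. gradient f x \<bullet> h)) (at x)"
    by (rule has_derivative_gradient[OF d[OF f2(1)]])
  have "((\<lambda>y. \<chi> i. partial_deriv i f y) has_derivative (\<lambda>h. \<chi> i. gradient (partial_deriv i f) x \<bullet> h)) (at x)"
    by (subst has_derivative_componentwise_within)
      (auto simp: Basis_vec_def inner_axis intro!: has_derivative_gradient[OF d[OF f2(2)]])
  moreover have "(\<chi> i. gradient (partial_deriv i f) x \<bullet> h) = hessian f x *v h" for h
    by (simp add: matrix_vector_mult_def hessian_def gradient_def inner_vec_def vec_eq_iff)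
  ultimately show "(gradient f has_derivative (\<lambda>h. hessian f x *v h)) (at x)"
    by (simp add: gradient_def[abs_def])
qed

lemma continuous_on_gradient:
  assumes "\<And>i. continuous_on S (partial_deriv i f)"
  shows "continuous_on S (gradient f)"
  unfolding gradient_def[abs_def] using assms by (intro continuous_on_vec_lambda)

lemma second_partial_continuous_on:
  "Ck_on 2 S f \<Longrightarrow> continuous_on S (partial_deriv j (partial_deriv i f))"
  by (simp add: numeral_2_eq_2)

lemma Ck_on_1_lipschitz:
  fixes f :: "real^'n \<Rightarrow> real"
  assumes U: "open U" and f: "Ck_on 1 U f" and C: "compact C" "convex C" "C \<subseteq> U"
  shows "\<exists>L\<ge>0. \<forall>x\<in>C. \<forall>y\<in>C. \<bar>f x - f y\<bar> \<le> L * norm (x - y)"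
proof -
  have "continuous_on U (gradient f)" using f by (intro continuous_on_gradient) simp
  then have "compact (gradient f ` C)"
    using C compact_continuous_image continuous_on_subset by blast
  then have "bounded (gradient f ` C)" by (rule compact_imp_bounded)
  then obtain L where L: "\<And>x. x \<in> C \<Longrightarrow> norm (gradient f x) \<le> L"
    unfolding bounded_iff by blast
  have "norm (f x - f y) \<le> \<bar>L\<bar> * norm (x - y)" if "x \<in> C" "y \<in> C" for x y
  proof (rule differentiable_bound[OF C(2) _ _ that])
    fix z assume z: "z \<in> C"
    have "f differentiable (at z)"
      using f z C(3) U by (auto simp: differentiable_on_eq_differentiable_at)
    then show "(f has_derivative (\<lambda>h. gradient f z \<bullet> h)) (at z within C)"
      by (rule has_derivative_at_withinI[OF has_derivative_gradient])
    show "onorm (\<lambda>h. gradient f z \<bullet> h) \<le> \<bar>L\<bar>"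
    proof (rule onorm_le)
      fix h :: "real^'n"
      have "norm (gradient f z) * norm h \<le> \<bar>L\<bar> * norm h"
        using L[OF z] by (intro mult_right_mono) auto
      then show "norm (gradient f z \<bullet> h) \<le> \<bar>L\<bar> * norm h"
        using Cauchy_Schwarz_ineq2[of "gradient f z" h] by simp
    qed
  qed
  then show ?thesis by (intro exI[of _ "\<bar>L\<bar>"]) auto
qed

lemma norm_matrix_vector_le:
  fixes A :: "real^'n^'n"
  assumes "\<And>i j. \<bar>A $ i $ j\<bar> \<le> B"
  shows "norm (A *v h) \<le> (real CARD('n))\<^sup>2 * B * norm h"
proof -
  have "onorm ((*v) A) \<le> real CARD('n) * real CARD('n) * B"
    using onorm_le_matrix_component[of A B] assms by simp
  then have "onorm ((*v) A) * norm h \<le> (real CARD('n))\<^sup>2 * B * norm h"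
    by (intro mult_right_mono) (auto simp: power2_eq_square)
  then show ?thesis
    using onorm[OF matrix_vector_mul_bounded_linear, of A h] by linarith
qed

text \<open>Third derivatives of the defining function enter here: they make its Hessian Lipschitz,
  which gives the quadratic remainder of the gradient in \<open>boundary_chart\<close>.\<close>

lemma hessian_bounds:
  fixes f :: "real^'n \<Rightarrow> real"
  assumes U: "open U" and f: "Ck_on 3 U f" and C: "compact C" "convex C" "C \<subseteq> U"
  obtains L where "L \<ge> 0" "\<And>x h. x \<in> C \<Longrightarrow> norm (hessian f x *v h) \<le> L * norm h"
    "\<And>x y h. x \<in> C \<Longrightarrow> y \<in> C \<Longrightarrow> norm ((hessian f x - hessian f y) *v h) \<le> L * norm (x - y) * norm h"
proof -
  have f3: "Ck_on 1 U (partial_deriv j (partial_deriv i f))" for i j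
    using f by (simp add: numeral_3_eq_3)
  have "\<forall>i j. \<exists>L. L \<ge> 0 \<and> (\<forall>x\<in>C. \<forall>y\<in>C. \<bar>partial_deriv j (partial_deriv i f) x - partial_deriv j (partial_deriv i f) y\<bar> \<le> L * norm (x - y))"
    using Ck_on_1_lipschitz[OF U f3 C] by blast
  then obtain L where L: "\<And>i j. L i j \<ge> 0"
    "\<And>i j x y. x \<in> C \<Longrightarrow> y \<in> C \<Longrightarrow> \<bar>partial_deriv j (partial_deriv i f) x - partial_deriv j (partial_deriv i f) y\<bar> \<le> L i j * norm (x - y)"
    by metis
  have "\<forall>i j. \<exists>N. \<forall>x\<in>C. \<bar>partial_deriv j (partial_deriv i f) x\<bar> \<le> N"
  proof (intro allI)
    fix i j
    have "partial_deriv j (partial_deriv i f) differentiable_on U" using f3 by simp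
    then have "continuous_on C (partial_deriv j (partial_deriv i f))"
      using C(3) differentiable_imp_continuous_on continuous_on_subset by blast
    then have "bounded (partial_deriv j (partial_deriv i f) ` C)"
      using C(1) compact_continuous_image compact_imp_bounded by blast
    then show "\<exists>N. \<forall>x\<in>C. \<bar>partial_deriv j (partial_deriv i f) x\<bar> \<le> N"
      unfolding bounded_iff by auto
  qed
  then obtain N where N: "\<And>i j x. x \<in> C \<Longrightarrow> \<bar>partial_deriv j (partial_deriv i f) x\<bar> \<le> N i j"
    by metis
  define Q where "Q = (\<Sum>i\<in>UNIV. \<Sum>j\<in>UNIV. L i j + \<bar>N i j\<bar>)"
  have le: "L i j + \<bar>N i j\<bar> \<le> Q" for i j
  proof -
    have "L i j + \<bar>N i j\<bar> \<le> (\<Sum>j\<in>UNIV. L i j + \<bar>N i j\<bar>)"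
      using L by (intro member_le_sum) auto
    also have "\<dots> \<le> Q" unfolding Q_def
      using L by (intro member_le_sum[of i UNIV "\<lambda>i. \<Sum>j\<in>UNIV. L i j + \<bar>N i j\<bar>"] sum_nonneg) auto
    finally show ?thesis .
  qed
  have Q: "Q \<ge> 0" unfolding Q_def using L by (intro sum_nonneg) auto
  show thesis
  proof
    show "(real CARD('n))\<^sup>2 * Q \<ge> 0" using Q by simp
    show "norm (hessian f x *v h) \<le> (real CARD('n))\<^sup>2 * Q * norm h" if "x \<in> C" for x h
    proof (rule norm_matrix_vector_le)
      show "\<bar>hessian f x $ i $ j\<bar> \<le> Q" for i j
        using N[OF that, of j i] le[of i j] L(1)[of i j] by (simp add: hessian_def)
    qed
    show "norm ((hessian f x - hessian f y) *v h) \<le> (real CARD('n))\<^sup>2 * Q * norm (x - y) * norm h"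
      if "x \<in> C" "y \<in> C" for x y h
    proof -
      have "\<bar>(hessian f x - hessian f y) $ i $ j\<bar> \<le> Q * norm (x - y)" for i j
      proof -
        have "L i j * norm (x - y) \<le> Q * norm (x - y)"
          using le[of i j] by (intro mult_right_mono) auto
        then show ?thesis using L(2)[OF that, of j i] by (simp add: hessian_def)
      qed
      from norm_matrix_vector_le[OF this] show ?thesis by (simp add: mult.assoc)
    qed
  qed
qed

text \<open>A compactness argument needs one \<open>K\<close> for all boundary points near
  \<open>q\<close>. Each chart is \<open>\<rho>\<close> divided by the length of its gradient at
  \<open>p\<close>, and these lengths are bounded below on a compact ball.\<close>

lemma local_boundary_charts:
  fixes \<Omega> :: "(real^'n) set"
  assumes \<Omega>: "closed \<Omega>" "smooth_boundary \<Omega>" and q: "q \<in> frontier \<Omega>"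
  shows "\<exists>s K. s > 0 \<and> K \<ge> 1 \<and> (\<forall>p\<in>frontier \<Omega> \<inter> ball q s. \<exists>\<rho> g B. boundary_chart \<Omega> K p \<rho> g B)"
proof -
  obtain U \<rho> where chart: "open U \<and> q \<in> U \<and> smooth_on U \<rho> \<and> (\<forall>x\<in>U. gradient \<rho> x \<noteq> 0) \<and>
      \<Omega> \<inter> U = {x \<in> U. \<rho> x \<le> 0}"
    using bspec[OF \<Omega>(2)[unfolded smooth_boundary_def] q] by (elim exE)
  then have U: "open U" "q \<in> U" and \<rho>: "smooth_on U \<rho>" and eq: "\<Omega> \<inter> U = {x \<in> U. \<rho> x \<le> 0}"
    by (simp_all only:)
  have grad: "\<And>x. x \<in> U \<Longrightarrow> gradient \<rho> x \<noteq> 0" using chart by blast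
  obtain s' where s': "s' > 0" "cball q s' \<subseteq> U" using U open_contains_cball by blast
  define s C where "s = s' / 2" and "C = cball q s'"
  have s: "s > 0" using s' by (simp add: s_def)
  have C: "compact C" "convex C" "C \<subseteq> U" using s' by (auto simp: C_def)
  have gh: "grad_hess_on U \<rho> (gradient \<rho>) (hessian \<rho>)"
    using \<rho> U by (intro grad_hess_on_Ck) (auto simp: smooth_on_def)
  obtain L where L: "L \<ge> 0" "\<And>x h. x \<in> C \<Longrightarrow> norm (hessian \<rho> x *v h) \<le> L * norm h"
    "\<And>x y h. x \<in> C \<Longrightarrow> y \<in> C \<Longrightarrow> norm ((hessian \<rho> x - hessian \<rho> y) *v h) \<le> L * norm (x - y) * norm h"
    using hessian_bounds[OF U(1) _ C, of \<rho>] \<rho> unfolding smooth_on_def by blast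
  have d1: "(\<rho> has_derivative (\<lambda>h. gradient \<rho> x \<bullet> h)) (at x within T)"
    and d2: "(gradient \<rho> has_derivative (\<lambda>h. hessian \<rho> x *v h)) (at x within T)" if "x \<in> C" for x T
    using gh that C(3) has_derivative_at_withinI unfolding grad_hess_on_def by blast+
  have seg: "closed_segment x y \<subseteq> C" if "x \<in> C" "y \<in> C" for x y
    using C(2) that by (rule closed_segment_subset[rotated 2])
  have seg_param: "x + t *\<^sub>R (y - x) \<in> closed_segment x y" if "0 \<le> t" "t \<le> 1" for x y :: "real^'n" and t
    unfolding closed_segment_def using that by (auto simp: algebra_simps intro!: exI[of _ t])
  have segnorm: "norm (z - x) \<le> norm (y - x)" if "z \<in> closed_segment x y" for x y z :: "real^'n"
    using segment_bound(1)[OF that] by (simp add: norm_minus_commute)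
  have grad_lip: "norm (gradient \<rho> x - gradient \<rho> y) \<le> L * norm (x - y)" if "x \<in> C" "y \<in> C" for x y
    by (rule differentiable_bound[OF C(2) d2 _ that]) (auto intro!: onorm_le L(2))
  have taylor1: "\<bar>\<rho> y - \<rho> x - gradient \<rho> x \<bullet> (y - x)\<bar> \<le> L * (norm (y - x))\<^sup>2" if "x \<in> C" "y \<in> C" for x y
  proof -
    have "norm (\<rho> y - \<rho> x - gradient \<rho> x \<bullet> (y - x)) \<le> norm (y - x) * (L * norm (y - x))"
    proof (rule differentiable_bound_linearization[of x y "closed_segment x y" \<rho> "\<lambda>z h. gradient \<rho> z \<bullet> h"])
      fix z assume z: "z \<in> closed_segment x y"
      then have zC: "z \<in> C" using seg that by blast
      show "(\<rho> has_derivative (\<lambda>h. gradient \<rho> z \<bullet> h)) (at z within closed_segment x y)" by (rule d1[OF zC])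
      show "onorm ((\<lambda>h. gradient \<rho> z \<bullet> h) - (\<lambda>h. gradient \<rho> x \<bullet> h)) \<le> L * norm (y - x)"
      proof (rule onorm_le)
        fix h :: "real^'n"
        have "norm (gradient \<rho> z - gradient \<rho> x) \<le> L * norm (y - x)"
          using grad_lip[OF zC that(1)] mult_left_mono[OF segnorm[OF z] L(1)] by linarith
        then have "norm (gradient \<rho> z - gradient \<rho> x) * norm h \<le> L * norm (y - x) * norm h"
          by (rule mult_right_mono) simp
        then show "norm (((\<lambda>h. gradient \<rho> z \<bullet> h) - (\<lambda>h. gradient \<rho> x \<bullet> h)) h) \<le> L * norm (y - x) * norm h"
          using Cauchy_Schwarz_ineq2[of "gradient \<rho> z - gradient \<rho> x" h] by (simp add: inner_diff_left)
      qed
    qed (use seg_param in auto)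
    then show ?thesis by (simp add: power2_eq_square mult_ac)
  qed
  have taylor2: "norm (gradient \<rho> x - gradient \<rho> p - hessian \<rho> p *v (x - p)) \<le> L * (norm (x - p))\<^sup>2"
    if "p \<in> C" "x \<in> C" for x p
  proof -
    have "norm (gradient \<rho> x - gradient \<rho> p - hessian \<rho> p *v (x - p)) \<le> norm (x - p) * (L * norm (x - p))"
    proof (rule differentiable_bound_linearization[of p x "closed_segment p x" "gradient \<rho>" "\<lambda>z h. hessian \<rho> z *v h"])
      fix z assume z: "z \<in> closed_segment p x"
      then have zC: "z \<in> C" using seg that by blast
      show "(gradient \<rho> has_derivative (\<lambda>h. hessian \<rho> z *v h)) (at z within closed_segment p x)" by (rule d2[OF zC])
      show "onorm ((\<lambda>h. hessian \<rho> z *v h) - (\<lambda>h. hessian \<rho> p *v h)) \<le> L * norm (x - p)"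
      proof (rule onorm_le)
        fix h :: "real^'n"
        have "L * norm (z - p) * norm h \<le> L * norm (x - p) * norm h"
          using segnorm[OF z] L(1) by (intro mult_right_mono mult_left_mono) auto
        then show "norm (((\<lambda>h. hessian \<rho> z *v h) - (\<lambda>h. hessian \<rho> p *v h)) h) \<le> L * norm (x - p) * norm h"
          using L(3)[OF zC that(1), of h] by (simp add: matrix_vector_mult_diff_rdistrib)
      qed
    qed (use seg_param in auto)
    then show ?thesis by (simp add: power2_eq_square mult_ac)
  qed
  have cont\<rho>: "continuous_on T \<rho>" if "T \<subseteq> C" for T
    unfolding continuous_on_eq_continuous_within using has_derivative_continuous[OF d1] that by blast
  have contg: "continuous_on C (gradient \<rho>)"
    unfolding continuous_on_eq_continuous_within using has_derivative_continuous[OF d2] by blast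
  have "q \<in> C" using s' by (simp add: C_def)
  then obtain x0 where x0: "x0 \<in> C" "\<And>x. x \<in> C \<Longrightarrow> norm (gradient \<rho> x0) \<le> norm (gradient \<rho> x)"
    using continuous_attains_inf[OF C(1) _ continuous_on_norm[OF contg]] by blast
  define m where "m = norm (gradient \<rho> x0)"
  have m: "m > 0" using grad x0 C(3) by (auto simp: m_def)
  \<comment> \<open>The second summand keeps \<open>ball p (1 / K)\<close> inside \<open>C\<close>,
    whose radius is \<open>2 * s\<close>; the third dominates all bounds after the division by the
    gradient length.\<close>
  define K where "K = 1 + 1 / s + L / m"
  have K: "K \<ge> 1" "1 / s \<le> K" "L / m \<le> K" using s L m by (auto simp: K_def)
  have Ks: "1 / K \<le> s" using K s by (simp add: field_simps)
  have "\<exists>\<rho> g B. boundary_chart \<Omega> K p \<rho> g B" if p: "p \<in> frontier \<Omega> \<inter> ball q s" for p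
  proof -
    have ballC: "ball p (1 / K) \<subseteq> C"
    proof
      fix x assume "x \<in> ball p (1 / K)"
      then have "dist p x < s" "dist q p < s" using Ks p by auto
      then show "x \<in> C" using dist_triangle[of q x p] by (simp add: C_def s_def)
    qed
    have pC: "p \<in> C" using ballC K by (auto simp: subset_iff)
    define c where "c = norm (gradient \<rho> p)"
    have c: "c > 0" "m \<le> c" using x0(2)[OF pC] m by (auto simp: c_def m_def)
    have Lc: "L / c * a \<le> K * a" if "a \<ge> 0" for a
    proof (rule mult_right_mono[OF _ that])
      have "L / c \<le> L / m" using L(1) m c by (intro divide_left_mono) auto
      then show "L / c \<le> K" using K by linarith
    qed
    have "p \<in> \<Omega>" using p \<Omega>(1) by (auto simp: frontier_def closure_closed)
    then have "\<rho> p \<le> 0" using eq pC C(3) by blast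
    moreover have "\<not> \<rho> p < 0"
    proof
      assume "\<rho> p < 0"
      have "open (ball p (1 / K) \<inter> \<rho> -` {..<0})"
        by (rule continuous_open_preimage[OF cont\<rho>[OF ballC]]) auto
      moreover have "p \<in> ball p (1 / K) \<inter> \<rho> -` {..<0}" using \<open>\<rho> p < 0\<close> K by simp
      moreover have "ball p (1 / K) \<inter> \<rho> -` {..<0} \<subseteq> \<Omega>" using eq ballC C(3) by force
      ultimately have "p \<in> interior \<Omega>" using interiorI by blast
      then show False using p by (simp add: frontier_def)
    qed
    ultimately have \<rho>p: "\<rho> p = 0" by simp
    have "boundary_chart \<Omega> K p (\<lambda>x. \<rho> x / c) (\<lambda>x. gradient \<rho> x /\<^sub>R c) (hessian \<rho> p /\<^sub>R c)"
      unfolding boundary_chart_def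
    proof (intro conjI ballI allI)
      show "continuous_on (ball p (1 / K)) (\<lambda>x. \<rho> x / c)"
        using c cont\<rho>[OF ballC] by (intro continuous_intros) auto
      show "\<rho> p / c = 0" using \<rho>p by simp
      show "norm (gradient \<rho> p /\<^sub>R c) = 1" using c by (simp add: c_def)
      fix x assume x: "x \<in> ball p (1 / K)"
      then have xC: "x \<in> C" using ballC by blast
      have "x \<in> \<Omega> \<longleftrightarrow> \<rho> x \<le> 0" using eq xC C(3) by blast
      then show "x \<in> \<Omega> \<longleftrightarrow> \<rho> x / c \<le> 0" using c by (simp add: divide_le_0_iff)
      have "gradient \<rho> x /\<^sub>R c - gradient \<rho> p /\<^sub>R c - (hessian \<rho> p /\<^sub>R c) *v (x - p)
          = (gradient \<rho> x - gradient \<rho> p - hessian \<rho> p *v (x - p)) /\<^sub>R c"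
        by (simp add: scaleR_matrix_vector_mult scaleR_diff_right)
      then have "norm (gradient \<rho> x /\<^sub>R c - gradient \<rho> p /\<^sub>R c - (hessian \<rho> p /\<^sub>R c) *v (x - p))
          = norm (gradient \<rho> x - gradient \<rho> p - hessian \<rho> p *v (x - p)) / c"
        using c by (simp add: divide_inverse mult.commute)
      also have "\<dots> \<le> L * (norm (x - p))\<^sup>2 / c" using taylor2[OF pC xC] c by (intro divide_right_mono) auto
      also have "\<dots> \<le> K * (norm (x - p))\<^sup>2" using Lc[of "(norm (x - p))\<^sup>2"] by simp
      finally show "norm (gradient \<rho> x /\<^sub>R c - gradient \<rho> p /\<^sub>R c - (hessian \<rho> p /\<^sub>R c) *v (x - p)) \<le> K * (norm (x - p))\<^sup>2" .
      fix y assume y: "y \<in> ball p (1 / K)"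
      then have yC: "y \<in> C" using ballC by blast
      have "\<rho> y / c - \<rho> x / c - (gradient \<rho> x /\<^sub>R c) \<bullet> (y - x) = (\<rho> y - \<rho> x - gradient \<rho> x \<bullet> (y - x)) / c"
        by (simp add: divide_inverse algebra_simps)
      then have "\<bar>\<rho> y / c - \<rho> x / c - (gradient \<rho> x /\<^sub>R c) \<bullet> (y - x)\<bar> = \<bar>\<rho> y - \<rho> x - gradient \<rho> x \<bullet> (y - x)\<bar> / c"
        using c by simp
      also have "\<dots> \<le> L * (norm (y - x))\<^sup>2 / c" using taylor1[OF xC yC] c by (intro divide_right_mono) auto
      also have "\<dots> \<le> K * (norm (y - x))\<^sup>2" using Lc[of "(norm (y - x))\<^sup>2"] by simp
      finally show "\<bar>\<rho> y / c - \<rho> x / c - (gradient \<rho> x /\<^sub>R c) \<bullet> (y - x)\<bar> \<le> K * (norm (y - x))\<^sup>2" .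
    next
      fix v
      have "norm ((hessian \<rho> p /\<^sub>R c) *v v) = norm (hessian \<rho> p *v v) / c"
        using c by (simp add: scaleR_matrix_vector_mult divide_inverse mult.commute)
      also have "\<dots> \<le> L * norm v / c" using L(2)[OF pC] c by (intro divide_right_mono) auto
      also have "\<dots> \<le> K * norm v" using Lc[of "norm v"] by simp
      finally show "norm ((hessian \<rho> p /\<^sub>R c) *v v) \<le> K * norm v" .
    qed
    then show ?thesis by blast
  qed
  then show ?thesis using s K by blast
qed

lemma boundary_chart_mono:
  assumes "boundary_chart \<Omega> K p \<rho> g B" "0 < K" "K \<le> K'"
  shows "boundary_chart \<Omega> K' p \<rho> g B"
proof -
  have sub: "ball p (1 / K') \<subseteq> ball p (1 / K)"
    using assms by (intro subset_ball divide_left_mono) auto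
  have le: "K * a \<le> K' * a" if "a \<ge> 0" for a using assms that by (intro mult_right_mono) auto
  note c = assms(1)[unfolded boundary_chart_def]
  show ?thesis
    unfolding boundary_chart_def
  proof (intro conjI ballI allI)
    show "continuous_on (ball p (1 / K')) \<rho>" using c sub continuous_on_subset by blast
    show "\<rho> p = 0" "norm (g p) = 1" using c by auto
    have "norm (B *v v) \<le> K * norm v" for v using c by blast
    then show "norm (B *v v) \<le> K' * norm v" for v using order_trans[OF _ le[OF norm_ge_zero]] by blast
    fix x assume x: "x \<in> ball p (1 / K')"
    then have x': "x \<in> ball p (1 / K)" using sub by blast
    show "x \<in> \<Omega> \<longleftrightarrow> \<rho> x \<le> 0" using c x' by blast
    have "norm (g x - g p - B *v (x - p)) \<le> K * (norm (x - p))\<^sup>2" using c x' by blast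
    then show "norm (g x - g p - B *v (x - p)) \<le> K' * (norm (x - p))\<^sup>2"
      using le[of "(norm (x - p))\<^sup>2"] by simp
    fix y assume "y \<in> ball p (1 / K')"
    then have "y \<in> ball p (1 / K)" using sub by blast
    then have "\<bar>\<rho> y - \<rho> x - g x \<bullet> (y - x)\<bar> \<le> K * (norm (y - x))\<^sup>2" using c x' by blast
    then show "\<bar>\<rho> y - \<rho> x - g x \<bullet> (y - x)\<bar> \<le> K' * (norm (y - x))\<^sup>2"
      using le[of "(norm (y - x))\<^sup>2"] by simp
  qed
qed

lemma uniform_boundary_charts:
  assumes \<Omega>: "compact \<Omega>" "smooth_boundary \<Omega>"
  obtains K where "K \<ge> 1" "\<And>p. p \<in> frontier \<Omega> \<Longrightarrow> \<exists>\<rho> g B. boundary_chart \<Omega> K p \<rho> g B"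
proof -
  have "\<forall>q\<in>frontier \<Omega>. \<exists>s K. s > 0 \<and> K \<ge> 1 \<and> (\<forall>p\<in>frontier \<Omega> \<inter> ball q s. \<exists>\<rho> g B. boundary_chart \<Omega> K p \<rho> g B)"
    using local_boundary_charts[OF compact_imp_closed[OF \<Omega>(1)] \<Omega>(2)] by blast
  then obtain s k where sk: "\<And>q. q \<in> frontier \<Omega> \<Longrightarrow> s q > (0::real)" "\<And>q. q \<in> frontier \<Omega> \<Longrightarrow> k q \<ge> (1::real)"
    "\<And>q p. q \<in> frontier \<Omega> \<Longrightarrow> p \<in> frontier \<Omega> \<Longrightarrow> p \<in> ball q (s q) \<Longrightarrow> \<exists>\<rho> g B. boundary_chart \<Omega> (k q) p \<rho> g B"
    by (metis IntI)
  have "compact (frontier \<Omega>)" by (rule compact_frontier[OF \<Omega>(1)])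
  moreover have "frontier \<Omega> \<subseteq> (\<Union>q\<in>frontier \<Omega>. ball q (s q))" using sk(1) by force
  ultimately obtain D where D: "D \<subseteq> frontier \<Omega>" "finite D" "frontier \<Omega> \<subseteq> (\<Union>q\<in>D. ball q (s q))"
    by (elim compactE_image) auto
  \<comment> \<open>A sum in place of a maximum, so that an empty \<open>D\<close> needs no separate
    treatment.\<close>
  define K where "K = 1 + (\<Sum>q\<in>D. k q)"
  have kD: "k q \<ge> 0" if "q \<in> D" for q using sk(2)[of q] D that by force
  have "\<exists>\<rho> g B. boundary_chart \<Omega> K p \<rho> g B" if p: "p \<in> frontier \<Omega>" for p
  proof -
    obtain q where q: "q \<in> D" "p \<in> ball q (s q)" using D p by blast
    have "q \<in> frontier \<Omega>" using q D by blast
    from sk(3)[OF this p q(2)] obtain \<rho> g B where chart: "boundary_chart \<Omega> (k q) p \<rho> g B" by (elim exE)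
    have "k q \<le> (\<Sum>q\<in>D. k q)" using q D kD by (intro member_le_sum) auto
    then have le: "k q \<le> K" by (simp add: K_def)
    have "0 < k q" using sk(2)[of q] q D by force
    from boundary_chart_mono[OF chart this le] have "boundary_chart \<Omega> K p \<rho> g B" .
    then show ?thesis by (rule_tac x=\<rho> in exI, rule_tac x=g in exI, rule_tac x=B in exI)
  qed
  moreover have "(\<Sum>q\<in>D. k q) \<ge> 0" using kD by (rule sum_nonneg)
  then have "K \<ge> 1" by (simp add: K_def)
  ultimately show thesis by (rule that[rotated])
qed

subsection \<open>Dirichlet eigenfunctions\<close>

text \<open>Segments may leave \<open>S\<close>. If one does so at z, then \<open>u\<close> is zero
  at z, and the value at either end is at most \<open>M\<close> times its distance to the
  complement: the largest ball in \<open>S\<close> about that end is convex and has a nearest point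
  of the complement in its closure. The two estimates add up along the segment.\<close>

lemma lipschitz_of_gradient_bound:
  fixes u :: "real^'n \<Rightarrow> real"
  assumes gh: "grad_hess_on S u G H" and cont: "continuous_on UNIV u"
    and outside: "\<And>x. x \<notin> S \<Longrightarrow> u x = 0"
    and M: "M \<ge> 0" and G: "\<And>x. x \<in> S \<Longrightarrow> norm (G x) \<le> M"
  shows "\<bar>u x - u y\<bar> \<le> M * norm (x - y)"
proof -
  have S: "open S" using gh by (simp add: grad_hess_on_def)
  have conv: "\<bar>u a - u b\<bar> \<le> M * norm (a - b)" if C: "convex C" "C \<subseteq> S" "a \<in> C" "b \<in> C" for a b C
  proof -
    have "norm (u a - u b) \<le> M * norm (a - b)"
    proof (rule differentiable_bound[OF C(1) _ _ C(3,4)])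
      fix z assume z: "z \<in> C"
      then have "(u has_derivative (\<lambda>h. G z \<bullet> h)) (at z)" using gh C(2) by (auto simp: grad_hess_on_def)
      then show "(u has_derivative (\<lambda>h. G z \<bullet> h)) (at z within C)" by (rule has_derivative_at_withinI)
      show "onorm (\<lambda>h. G z \<bullet> h) \<le> M"
      proof (rule onorm_le)
        fix h :: "real^'n"
        have "norm (G z) * norm h \<le> M * norm h"
          using G z C(2) by (intro mult_right_mono) auto
        then show "norm (G z \<bullet> h) \<le> M * norm h"
          using Cauchy_Schwarz_ineq2[of "G z" h] by simp
      qed
    qed
    then show ?thesis by simp
  qed
  have out: "\<bar>u a\<bar> \<le> M * norm (a - z)" if z: "z \<notin> S" for a z
  proof (cases "a \<in> S")
    case False
    then show ?thesis using outside M by simp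
  next
    case True
    have "closed (- S)" "- S \<noteq> {}" using S z by (auto simp: closed_Compl)
    then obtain p where p: "p \<in> - S" "\<And>y. y \<in> - S \<Longrightarrow> dist a p \<le> dist a y"
      using distance_attains_inf[of "- S" a] by blast
    define d where "d = dist a p"
    have ball: "ball a d \<subseteq> S" using p(2) by (force simp: d_def)
    have d: "d > 0" using p True by (auto simp: d_def)
    have "ball a d \<subseteq> {y. \<bar>u a - u y\<bar> \<le> M * norm (a - y)}"
      using conv[OF convex_ball ball] d by auto
    moreover have "closed {y. \<bar>u a - u y\<bar> \<le> M * norm (a - y)}"
      using cont by (intro closed_Collect_le continuous_intros)
    ultimately have "closure (ball a d) \<subseteq> {y. \<bar>u a - u y\<bar> \<le> M * norm (a - y)}"
      by (rule closure_minimal)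
    moreover have "p \<in> closure (ball a d)" using d by (simp add: d_def)
    ultimately have "\<bar>u a - u p\<bar> \<le> M * norm (a - p)" by blast
    moreover have "M * norm (a - p) \<le> M * norm (a - z)"
      using p(2)[of z] z M by (intro mult_left_mono) (auto simp: dist_norm)
    ultimately show ?thesis using outside[of p] p by simp
  qed
  show ?thesis
  proof (cases "closed_segment x y \<subseteq> S")
    case True
    then show ?thesis by (intro conv[OF convex_closed_segment]) auto
  next
    case False
    then obtain z where z: "z \<in> closed_segment x y" "z \<notin> S" by blast
    then have "dist x y = dist x z + dist z y" by (metis between between_mem_segment)
    then have "M * norm (x - y) = M * norm (x - z) + M * norm (y - z)"
      by (simp add: dist_norm norm_minus_commute distrib_left)
    then show ?thesis using out[OF z(2), of x] out[OF z(2), of y] by linarith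
  qed
qed

section \<open>Lower bound for the eigenvalue\<close>

context lipschitz_eigenfunction
begin

lemma continuous_on_u: "continuous_on T u"
proof (rule lipschitz_on_continuous_on)
  show "M-lipschitz_on T u"
    using lipschitz M by (intro lipschitz_onI) (auto simp: dist_norm)
qed

text \<open>A Poincare-type bound by the minimum principle: for smaller \<open>lam\<close> a concave
  quadratic \<open>W\<close> with values at most \<open>m / 2\<close> would have to dominate the
  maximum \<open>m\<close> of \<bar>u\<bar>.\<close>

lemma eigenvalue_ge:
  assumes R: "R > 0" "S \<subseteq> cball 0 R" and u: "u x \<noteq> 0"
  shows "lam \<ge> 1 / (2 * R\<^sup>2)"
proof (rule ccontr)
  assume "\<not> ?thesis"
  then have lt: "lam < 1 / (2 * R\<^sup>2)" by simp
  obtain x0 where x0: "x0 \<in> cball 0 R" "\<And>y. y \<in> cball 0 R \<Longrightarrow> \<bar>u y\<bar> \<le> \<bar>u x0\<bar>"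
    using continuous_attains_sup[of "cball 0 R" "\<lambda>x. \<bar>u x\<bar>"] continuous_on_u R
    by (force intro!: continuous_intros)
  define m where "m = \<bar>u x0\<bar>"
  have "x \<in> cball 0 R" using R u outside by blast
  then have m: "m > 0" using x0(2)[of x] u by (simp add: m_def)
  define \<sigma> where "\<sigma> = - sgn (u x0)"
  have \<sigma>: "\<sigma> * u x0 = - m" "\<bar>\<sigma>\<bar> = 1" using m by (auto simp: \<sigma>_def m_def sgn_if)
  \<comment> \<open>Then \<open>W\<close> is at least \<open>m / 4\<close> on the ball, hence
    positive where \<open>u\<close> vanishes, while its Laplacian is at most - m / (2 R^2), which
    beats \<open>lam * m\<close>.\<close>
  define a where "a = m / (4 * R\<^sup>2)"
  have a: "a > 0" using m R by (simp add: a_def)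
  define W where "W = (\<lambda>z::real^'n. (- a) * ((z - 0) \<bullet> (z - 0)) + 0 * (0 \<bullet> (z - 0)) + 0 * (0 \<bullet> (z - 0))\<^sup>2 + m / 2)"
  have W: "W z = m / 2 - a * (norm z)\<^sup>2" for z by (simp add: W_def power2_norm_eq_inner)
  have "W x0 + \<sigma> * u x0 \<ge> 0"
  proof (rule weak_minimum_principle[of "cball 0 R"])
    show "continuous_on (cball 0 R) (\<lambda>z. W z + \<sigma> * u z)"
      unfolding W by (intro continuous_intros continuous_on_u)
    fix z :: "real^'n" assume z: "z \<in> cball 0 R"
    show "0 \<le> W z + \<sigma> * u z \<or> (\<exists>S G H. grad_hess_on S (\<lambda>z. W z + \<sigma> * u z) G H \<and> z \<in> S \<and> S \<subseteq> cball 0 R \<and> trace (H z) < 0)"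
    proof (cases "z \<in> S")
      case False
      have "(norm z)\<^sup>2 \<le> R\<^sup>2" using z by (intro power_mono) auto
      then have "a * (norm z)\<^sup>2 \<le> a * R\<^sup>2" using a by (intro mult_left_mono) auto
      also have "\<dots> = m / 4" using R by (simp add: a_def)
      finally show ?thesis using outside[OF False] m by (simp add: W)
    next
      case True
      have "grad_hess_on S (\<lambda>z. W z + \<sigma> * u z)
          (\<lambda>z. ((2 * - a) *\<^sub>R (z - 0) + (0 + 2 * 0 * (0 \<bullet> (z - 0))) *\<^sub>R 0) + \<sigma> *\<^sub>R G z)
          (\<lambda>z. ((2 * - a) *\<^sub>R mat 1 + (2 * 0) *\<^sub>R outer_square 0) + \<sigma> *\<^sub>R H z)"
        unfolding W_def using gh
        by (intro grad_hess_on_add grad_hess_on_cmult grad_hess_on_subset[OF grad_hess_on_quadratic])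
          (auto simp: grad_hess_on_def)
      moreover have "trace (((2 * - a) *\<^sub>R mat 1 + (2 * 0) *\<^sub>R outer_square 0) + \<sigma> *\<^sub>R H z) < 0"
      proof -
        have "\<bar>\<sigma> * trace (H z)\<bar> = lam * \<bar>u z\<bar>"
          using \<sigma> lam eigen[OF True] by (simp add: abs_mult)
        also have "\<dots> \<le> lam * m" unfolding m_def using lam x0(2)[OF z] by (intro mult_left_mono) auto
        also have "\<dots> < 1 / (2 * R\<^sup>2) * m" using lt m by (rule mult_strict_right_mono)
        also have "\<dots> = 2 * a * 1" by (simp add: a_def)
        also have "\<dots> \<le> 2 * a * CARD('n)" using a by (intro mult_left_mono) (auto simp: Suc_leI)
        finally show ?thesis
          unfolding trace_add[of _ "\<sigma> *\<^sub>R _"] trace_quadratic trace_scaleR by simp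
      qed
      ultimately show ?thesis using True R by blast
    qed
  qed (use x0 in auto)
  moreover have "a * (norm x0)\<^sup>2 \<ge> 0" using a by simp
  ultimately show False using \<sigma> m by (simp add: W)
qed

end

text \<open>The set where the bound fails is open, by continuity of the gradient, and null, hence
  empty.\<close>

lemma gradient_le_of_AE:
  fixes \<phi> :: "real^'n \<Rightarrow> real"
  assumes S: "open S" and cont: "continuous_on S (gradient \<phi>)"
    and ae: "AE x in lebesgue_on S. norm (gradient \<phi> x) \<le> M" and x: "x \<in> S"
  shows "norm (gradient \<phi> x) \<le> M"
proof (rule ccontr)
  assume neg: "\<not> ?thesis"
  define A where "A = S \<inter> gradient \<phi> -` {v. M < norm v}"
  have A: "open A" unfolding A_def
    by (rule continuous_open_preimage[OF cont S]) (intro open_Collect_less continuous_intros)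
  have "x \<in> A" using x neg by (simp add: A_def)
  have "AE x in lebesgue. x \<in> S \<longrightarrow> norm (gradient \<phi> x) \<le> M"
    using ae S by (subst (asm) AE_restrict_space_iff) auto
  then have "AE x in lebesgue. x \<notin> A" by eventually_elim (auto simp: A_def)
  then have "A \<in> null_sets lebesgue" using A by (subst (asm) AE_iff_null_sets[symmetric]) auto
  then have "negligible A" by (simp add: negligible_iff_null_sets)
  then show False using open_not_negligible[OF A] \<open>x \<in> A\<close> by blast
qed

lemma dir_deriv_dir_deriv:
  assumes gh: "grad_hess_on S f G H" and x: "x \<in> S"
  shows "dir_deriv v (dir_deriv v f) x = (H x *v v) \<bullet> v"
proof -
  have S: "open S" using gh by (simp add: grad_hess_on_def)
  have "((\<lambda>y. G y \<bullet> v) has_derivative (\<lambda>h. (H x *v h) \<bullet> v)) (at x)"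
    using gh x by (intro has_derivative_inner_left) (auto simp: grad_hess_on_def)
  then have "(dir_deriv v f has_derivative (\<lambda>h. (H x *v h) \<bullet> v)) (at x)"
  proof (rule has_derivative_transform_within_open[OF _ S x])
    fix y assume "y \<in> S"
    then have "(f has_derivative (\<lambda>h. G y \<bullet> h)) (at y)" using gh by (auto simp: grad_hess_on_def)
    then show "G y \<bullet> v = dir_deriv v f y" by (simp add: dir_deriv_has_derivative)
  qed
  then show ?thesis by (rule dir_deriv_has_derivative)
qed

text \<open>The supremum is over uncountably many directions, but each second directional derivative
  is continuous, so superlevel sets are unions of open sets.\<close>

lemma hessian_size_measurable:
  fixes f :: "real^'n \<Rightarrow> real"
  assumes S: "open S" and f: "Ck_on 2 S f"
  shows "hessian_size f \<in> borel_measurable (lebesgue_on S)"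
proof (rule borel_measurableI_greater)
  fix a :: ennreal
  define E where "E v = S \<inter> (\<lambda>x. ennreal \<bar>(hessian f x *v v) \<bullet> v\<bar>) -` {a<..}" for v
  have E: "open (E v)" for v
    unfolding E_def
  proof (rule continuous_open_preimage[OF _ S])
    have "continuous_on S (\<lambda>x. (\<Sum>i\<in>UNIV. (\<Sum>j\<in>UNIV. partial_deriv j (partial_deriv i f) x * v $ j) * v $ i))"
      using second_partial_continuous_on[OF f] by (intro continuous_intros) auto
    then have "continuous_on S (\<lambda>x. (hessian f x *v v) \<bullet> v)"
      by (simp add: matrix_vector_mult_def hessian_def inner_vec_def)
    then show "continuous_on S (\<lambda>x. ennreal \<bar>(hessian f x *v v) \<bullet> v\<bar>)"
      by (intro continuous_on_ennreal continuous_on_rabs)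
  qed simp
  have "{x \<in> space (lebesgue_on S). a < hessian_size f x} = (\<Union>v\<in>sphere 0 1. E v)"
    by (auto simp: E_def hessian_size_def less_SUP_iff dir_deriv_dir_deriv[OF grad_hess_on_Ck[OF S f]])
  moreover have "open (\<Union>v\<in>sphere 0 1. E v)" using E by blast
  moreover have "(\<Union>v\<in>sphere 0 1. E v) \<subseteq> S" by (auto simp: E_def)
  ultimately show "{x \<in> space (lebesgue_on S). a < hessian_size f x} \<in> sets (lebesgue_on S)"
    using S by (auto simp: sets_restrict_space_iff intro: borel_open)
qed

text \<open>Continuity of the extension is obtained by gluing over the closed sets \<Omega> and
  \<open>- S\<close>: on their overlap, the frontier, the Dirichlet condition makes both pieces
  zero.\<close>

lemma zero_extension_eigenfunction:
  fixes \<phi> :: "real^'n \<Rightarrow> real"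
  assumes \<Omega>: "compact \<Omega>" and eig: "dirichlet_eigenfunction \<Omega> lam \<phi>" and lam: "lam > 0"
    and M: "M \<ge> 0" "\<And>x. x \<in> interior \<Omega> \<Longrightarrow> norm (gradient \<phi> x) \<le> M"
  shows "lipschitz_eigenfunction (interior \<Omega>) (\<lambda>x. if x \<in> interior \<Omega> then \<phi> x else 0)
    (gradient \<phi>) (hessian \<phi>) M lam"
    and "\<exists>x\<in>interior \<Omega>. \<phi> x \<noteq> 0"
proof -
  define S where "S = interior \<Omega>"
  define u where "u = (\<lambda>x. if x \<in> S then \<phi> x else 0)"
  have S: "open S" "S \<subseteq> \<Omega>" by (auto simp: S_def interior_subset)
  have closed: "closed \<Omega>" using \<Omega> by (rule compact_imp_closed)
  note e = eig[unfolded dirichlet_eigenfunction_def, folded S_def]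
  have zero: "\<phi> x = 0" if "x \<in> \<Omega>" "x \<notin> S" for x
    using e that closed by (auto simp: frontier_def closure_closed S_def)
  obtain x1 where x1: "x1 \<in> S" "\<phi> x1 \<noteq> 0" using e zero by blast
  then show "\<exists>x\<in>interior \<Omega>. \<phi> x \<noteq> 0" by (auto simp: S_def)
  have gh\<phi>: "grad_hess_on S \<phi> (gradient \<phi>) (hessian \<phi>)"
    using e S by (intro grad_hess_on_Ck) auto
  have gh: "grad_hess_on S u (gradient \<phi>) (hessian \<phi>)"
    unfolding grad_hess_on_def
  proof (intro conjI ballI S)
    fix x assume x: "x \<in> S"
    then show "(gradient \<phi> has_derivative (\<lambda>h. hessian \<phi> x *v h)) (at x)"
      using gh\<phi> by (auto simp: grad_hess_on_def)
    have "(\<phi> has_derivative (\<lambda>h. gradient \<phi> x \<bullet> h)) (at x)" using gh\<phi> x by (auto simp: grad_hess_on_def)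
    then show "(u has_derivative (\<lambda>h. gradient \<phi> x \<bullet> h)) (at x)"
      by (rule has_derivative_transform_within_open[OF _ S(1) x]) (simp add: u_def)
  qed
  have "continuous_on (\<Omega> \<union> - S) u"
  proof (rule continuous_on_closed_Un[OF closed])
    show "closed (- S)" using S by (simp add: closed_Compl)
    have "continuous_on \<Omega> \<phi>" using e by blast
    then show "continuous_on \<Omega> u"
      by (rule continuous_on_eq) (auto simp: u_def zero)
    show "continuous_on (- S) u"
      by (rule continuous_on_eq[OF continuous_on_const[of _ 0]]) (auto simp: u_def)
  qed
  moreover have "\<Omega> \<union> - S = UNIV" using S by auto
  ultimately have cont: "continuous_on UNIV u" by simp
  have lip: "\<bar>u x - u y\<bar> \<le> M * norm (x - y)" for x y
    by (rule lipschitz_of_gradient_bound[OF gh cont _ M(1)]) (use M(2) in \<open>auto simp: u_def S_def\<close>)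
  \<comment> \<open>A nonzero value at \<open>x1\<close> and a zero outside the bounded set
    \<open>S\<close> exclude \<open>M = 0\<close>, so that \<open>M\<close> is positive as the
    locale demands.\<close>
  have "S \<noteq> UNIV"
    using bounded_subset[OF compact_imp_bounded[OF \<Omega>] S(2)] not_bounded_UNIV by auto
  then obtain z where "z \<notin> S" by blast
  then have "u x1 \<noteq> u z" using x1 by (simp add: u_def)
  then have "M \<noteq> 0" using lip[of x1 z] by auto
  then have "lipschitz_eigenfunction S u (gradient \<phi>) (hessian \<phi>) M lam"
    using e M lam gh lip by unfold_locales (auto simp: u_def S_def trace_hessian)
  then show "lipschitz_eigenfunction (interior \<Omega>) (\<lambda>x. if x \<in> interior \<Omega> then \<phi> x else 0)
    (gradient \<phi>) (hessian \<phi>) M lam"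
    by (simp add: u_def S_def)
qed

lemma eigenfunction_hessian_size_le:
  fixes \<Omega> :: "(real^'n) set"
  assumes "smooth_compact_domain \<Omega>"
  obtains c where "c > 0"
    "\<And>lam \<phi> M x. lam > 0 \<Longrightarrow> dirichlet_eigenfunction \<Omega> lam \<phi> \<Longrightarrow> M \<ge> 0 \<Longrightarrow>
      (\<And>y. y \<in> interior \<Omega> \<Longrightarrow> norm (gradient \<phi> y) \<le> M) \<Longrightarrow> x \<in> interior \<Omega> \<Longrightarrow>
      hessian_size \<phi> x \<le> ennreal (c * sqrt lam * M)"
proof -
  have \<Omega>: "compact \<Omega>" "smooth_boundary \<Omega>" using assms by (auto simp: smooth_compact_domain_def)
  obtain K where K: "K \<ge> 1" "\<And>p. p \<in> frontier \<Omega> \<Longrightarrow> \<exists>\<rho> g B. boundary_chart \<Omega> K p \<rho> g B"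
    using uniform_boundary_charts[OF \<Omega>] by blast
  obtain R where R: "R > 0" "\<Omega> \<subseteq> cball 0 R"
    using compact_imp_bounded[OF \<Omega>(1)] unfolding bounded_pos by (auto simp: subset_iff)
  define n where "n = real CARD('n)"
  have n: "n > 0" by (simp add: n_def)
  \<comment> \<open>For \<open>r = c1 / sqrt lam\<close>, the bound 1 gives
    \<open>lam * r^2 \<le> 1\<close>, and the other one gives \<open>16 * n * K * r \<le> 1\<close>
    because \<open>sqrt lam\<close> is at least 1 / (2 R). Only \<Omega> enters, through
    \<open>K\<close>, \<open>R\<close> and the dimension.\<close>
  define c1 where "c1 = min 1 (1 / (32 * n * K * R))"
  have c1: "0 < c1" "c1 \<le> 1" "c1 \<le> 1 / (32 * n * K * R)" using n K R by (auto simp: c1_def)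
  define c where "c = 550 * n ^ 3 / c1"
  have "hessian_size \<phi> x \<le> ennreal (c * sqrt lam * M)"
    if lam: "lam > 0" and eig: "dirichlet_eigenfunction \<Omega> lam \<phi>" and M: "M \<ge> 0"
      "\<And>y. y \<in> interior \<Omega> \<Longrightarrow> norm (gradient \<phi> y) \<le> M" and x: "x \<in> interior \<Omega>" for lam \<phi> M x
  proof -
    obtain x1 where x1: "x1 \<in> interior \<Omega>" "\<phi> x1 \<noteq> 0"
      using zero_extension_eigenfunction(2)[OF \<Omega>(1) eig lam M] by blast
    interpret lipschitz_eigenfunction "interior \<Omega>" "\<lambda>x. if x \<in> interior \<Omega> then \<phi> x else 0"
      "gradient \<phi>" "hessian \<phi>" M lam
      by (rule zero_extension_eigenfunction(1)[OF \<Omega>(1) eig lam M])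
    have "interior \<Omega> \<subseteq> cball 0 R" using R interior_subset by blast
    then have lam_ge: "lam \<ge> 1 / (2 * R\<^sup>2)" using eigenvalue_ge[OF R(1), of x1] x1 by simp
    define r where "r = c1 / sqrt lam"
    have r: "r > 0" using c1 lam by (simp add: r_def)
    have lr: "lam * r\<^sup>2 \<le> 1"
      using lam c1 by (simp add: r_def power_divide power_le_one)
    have "1 \<le> 2 * R * sqrt lam"
    proof -
      have "1 / (4 * R\<^sup>2) \<le> 1 / (2 * R\<^sup>2)" using R by (intro divide_left_mono) auto
      then have "(1 / (2 * R))\<^sup>2 \<le> lam" using lam_ge by (simp add: power2_eq_square)
      then have "1 / (2 * R) \<le> sqrt lam" by (rule real_le_rsqrt)
      then show ?thesis using R by (simp add: field_simps)
    qed
    then have "1 \<le> 2 * R * sqrt lam" .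
    have "16 * n * K * r \<le> 16 * n * K * (1 / (32 * n * K * R) / sqrt lam)"
      unfolding r_def using n K c1 lam by (intro mult_left_mono divide_right_mono) auto
    also have "\<dots> = 1 / (2 * R * sqrt lam)" using n K R lam by (simp add: field_simps)
    also have "\<dots> \<le> 1" using \<open>1 \<le> 2 * R * sqrt lam\<close> by simp
    finally have rK: "16 * CARD('n) * K * r \<le> 1" by (simp add: n_def)
    have "\<bar>dir_deriv v (dir_deriv v \<phi>) x\<bar> \<le> c * sqrt lam * M" if v: "norm v = 1" for v
    proof -
      have "\<bar>(hessian \<phi> x *v v) \<bullet> v\<bar> \<le> 550 * CARD('n) ^ 3 * M / r"
        by (rule second_derivative_le[OF HOL.refl \<Omega>(1) K(2) K(1) r rK lr x v])
      also have "550 * CARD('n) ^ 3 * M / r = c * sqrt lam * M"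
        using c1 lam by (simp add: c_def r_def n_def field_simps)
      finally show ?thesis
        using dir_deriv_dir_deriv[OF grad_hess_on_Ck x, of \<phi> v] eig by (simp add: dirichlet_eigenfunction_def)
    qed
    then show ?thesis
      unfolding hessian_size_def by (intro SUP_least ennreal_leI) auto
  qed
  moreover have "c > 0" using n c1 by (simp add: c_def)
  ultimately show thesis by (rule that[rotated])
qed

theorem theorem2:
  fixes \<Omega> :: "(real ^ 'n) set"
  assumes "smooth_compact_domain \<Omega>"
  shows "\<exists>c>0. \<forall>lam \<phi>. 0 < lam \<longrightarrow> dirichlet_eigenfunction \<Omega> lam \<phi> \<longrightarrow>
    Linf_norm \<Omega> (hessian_size \<phi>)
      \<le> ennreal (c * sqrt lam) * Linf_norm \<Omega> (\<lambda>x. ennreal (norm (gradient \<phi> x)))"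
proof -
  obtain c where c: "c > 0"
    "\<And>lam \<phi> M x. lam > 0 \<Longrightarrow> dirichlet_eigenfunction \<Omega> lam \<phi> \<Longrightarrow> M \<ge> 0 \<Longrightarrow>
      (\<And>y. y \<in> interior \<Omega> \<Longrightarrow> norm (gradient \<phi> y) \<le> M) \<Longrightarrow> x \<in> interior \<Omega> \<Longrightarrow>
      hessian_size \<phi> x \<le> ennreal (c * sqrt lam * M)"
    by (rule eigenfunction_hessian_size_le[OF assms]) blast
  have "Linf_norm \<Omega> (hessian_size \<phi>) \<le> ennreal (c * sqrt lam) * Linf_norm \<Omega> (\<lambda>x. ennreal (norm (gradient \<phi> x)))"
    if lam: "0 < lam" and eig: "dirichlet_eigenfunction \<Omega> lam \<phi>" for lam \<phi>
  proof (cases "Linf_norm \<Omega> (\<lambda>x. ennreal (norm (gradient \<phi> x))) = top")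
    \<comment> \<open>The right-hand side is infinite because its first factor is positive.\<close>
    case True
    then show ?thesis using c(1) lam by (simp add: ennreal_mult_top)
  next
    case False
    define M where "M = enn2real (Linf_norm \<Omega> (\<lambda>x. ennreal (norm (gradient \<phi> x))))"
    have M: "M \<ge> 0" "Linf_norm \<Omega> (\<lambda>x. ennreal (norm (gradient \<phi> x))) = ennreal M"
      using False by (auto simp: M_def less_top)
    have Ck: "Ck_on 2 (interior \<Omega>) \<phi>" using eig by (simp add: dirichlet_eigenfunction_def)
    then have "\<And>i. partial_deriv i \<phi> differentiable_on interior \<Omega>" by (simp add: numeral_2_eq_2)
    then have cont: "continuous_on (interior \<Omega>) (gradient \<phi>)"
      by (intro continuous_on_gradient differentiable_imp_continuous_on)
    have "AE x in lebesgue_on (interior \<Omega>). ennreal (norm (gradient \<phi> x)) \<le> ennreal M"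
      using esssup_AE[of "\<lambda>x. ennreal (norm (gradient \<phi> x))" "lebesgue_on (interior \<Omega>)"] M(2)
      by (simp add: Linf_norm_def)
    then have ae: "AE x in lebesgue_on (interior \<Omega>). norm (gradient \<phi> x) \<le> M"
      using M(1) by simp
    have G: "norm (gradient \<phi> y) \<le> M" if "y \<in> interior \<Omega>" for y
      by (rule gradient_le_of_AE[OF open_interior cont ae that])
    have "Linf_norm \<Omega> (hessian_size \<phi>) \<le> ennreal (c * sqrt lam * M)"
      unfolding Linf_norm_def
    proof (rule esssup_I)
      show "hessian_size \<phi> \<in> borel_measurable (lebesgue_on (interior \<Omega>))"
        by (rule hessian_size_measurable[OF open_interior Ck])
      show "AE x in lebesgue_on (interior \<Omega>). hessian_size \<phi> x \<le> ennreal (c * sqrt lam * M)"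
        using c(2)[OF lam eig M(1) G] by (intro AE_I2) simp
    qed
    then show ?thesis using M c(1) lam by (simp add: ennreal_mult)
  qed
  then show ?thesis using c(1) by blast
qed

end
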